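(* Let $L>K\ge1$ and $0<\Delta<0.5$. Let $E=\{1,\dots,L\}$ and let $B_1,\dots,B_K$ be a partition of $E$ into nonempty sets. Let $\mathcal I=\{I\subseteq E:\ |I\cap B_k|\le1\ \text{for all }k\}$ (a partition matroid of rank $K$). Let $P$ be the distribution under which the weights $w(e)$, $e\in E$, are independent Bernoulli random variables with means $\bar w(e)=0.5$ if $e=\min_{i\in B_k}i$ for the block $B_k$ containing $e$, and $\bar w(e)=0.5-\Delta$ otherwise. Then for any consistent algorithm, the expected cumulative regret on the matroid bandit $((E,\mathcal I),P)$ satisfies $$\liminf_{n\to\infty}\frac{R(n)}{\log n}\ge\frac{L-K}{4\Delta}.$$
   Context: A matroid bandit is a pair $(M,P)$ where $M=(E,\mathcal I)$ is a matroid on $E=\{1,\dots,L\}$ and $P$ is a distribution on $[0,1]^L$; in each episode $t$ a weight vector $w_t\sim P$ is drawn i.i.d., the algorithm chooses a basis (maximal independent set) $A^t$ based on past observations, gains $f(A^t,w_t)=\sum_{e\in A^t}w_t(e)$ and observes $w_t(e)$ for $e\in A^t$. With $\bar w=\mathbb E[w]$ and $A^*$ a basis maximizing $\sum_{e\in A}\bar w(e)$, the expected cumulative regret is $R(n)=\mathbb E\big[\sum_{t=1}^n(f(A^*,w_t)-f(A^t,w_t))\big]$. An algorithm is consistent if for every matroid bandit, every suboptimal item $e\in E\setminus A^*$ and every $\alpha>0$, $\mathbb E[T_e(n)]=o(n^\alpha)$, where $T_e(n)$ is the number of episodes among the first $n$ in which $e$ is chosen. *)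

theory Defs
  imports "HOL-Probability.Probability" "HOL-Library.Landau_Symbols"
begin

definition matroid :: "'a set \<Rightarrow> 'a set set \<Rightarrow> bool" where
  "matroid E \<I> \<longleftrightarrow> finite E \<and> \<I> \<subseteq> Pow E \<and> {} \<in> \<I> \<and>
     (\<forall>X Y. X \<in> \<I> \<and> Y \<subseteq> X \<longrightarrow> Y \<in> \<I>) \<and>
     (\<forall>X Y. X \<in> \<I> \<and> Y \<in> \<I> \<and> card X < card Y \<longrightarrow> (\<exists>e\<in>Y - X. insert e X \<in> \<I>))"

definition basis :: "'a set set \<Rightarrow> 'a set \<Rightarrow> bool" where
  "basis \<I> A \<longleftrightarrow> A \<in> \<I> \<and> (\<forall>B\<in>\<I>. A \<subseteq> B \<longrightarrow> B = A)"

definition weight_space :: "nat \<Rightarrow> (nat \<Rightarrow> real) measure" where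
  "weight_space L = PiM {1..L} (\<lambda>_. borel)"

definition bandit_dist :: "nat \<Rightarrow> (nat \<Rightarrow> real) measure \<Rightarrow> bool" where
  "bandit_dist L P \<longleftrightarrow> prob_space P \<and> sets P = sets (weight_space L) \<and>
     (AE w in P. \<forall>e\<in>{1..L}. 0 \<le> w e \<and> w e \<le> 1)"

definition mean_weight :: "(nat \<Rightarrow> real) measure \<Rightarrow> nat \<Rightarrow> real" where
  "mean_weight P e = (\<integral>w. w e \<partial>P)"

definition optimal_bases :: "nat \<Rightarrow> nat set set \<Rightarrow> (nat \<Rightarrow> real) measure \<Rightarrow> nat set set" where
  "optimal_bases L \<I> P = {A. basis \<I> A \<and>
      (\<forall>B. basis \<I> B \<longrightarrow> (\<Sum>e\<in>B. mean_weight P e) \<le> (\<Sum>e\<in>A. mean_weight P e))}"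

definition opt_basis :: "nat \<Rightarrow> nat set set \<Rightarrow> (nat \<Rightarrow> real) measure \<Rightarrow> nat set" where
  "opt_basis L \<I> P = (SOME A. A \<in> optimal_bases L \<I> P)"

text \<open>A history is the list of past (chosen basis, observed weights on it).
  A (possibly randomized) algorithm is given by a seed distribution \<open>U\<close> on \<open>'u\<close> and
  a policy \<open>\<pi> L \<I> u h\<close> that, knowing the matroid \<open>({1..L}, \<I>)\<close>, the internal seed \<open>u\<close>
  and the history \<open>h\<close> (whose length is the current episode index), picks a set.\<close>

type_synonym history = "(nat set \<times> (nat \<Rightarrow> real)) list"
type_synonym 'u policy = "nat \<Rightarrow> nat set set \<Rightarrow> 'u \<Rightarrow> history \<Rightarrow> nat set"

primrec hist :: "'u policy \<Rightarrow> nat \<Rightarrow> nat set set \<Rightarrow> 'u \<Rightarrow> (nat \<Rightarrow> nat \<Rightarrow> real) \<Rightarrow> nat \<Rightarrow> history" where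
  "hist \<pi> L \<I> u ws 0 = []"
| "hist \<pi> L \<I> u ws (Suc t) =
     (let A = \<pi> L \<I> u (hist \<pi> L \<I> u ws t) in hist \<pi> L \<I> u ws t @ [(A, restrict (ws t) A)])"

text \<open>The basis chosen in episode \<open>t\<close> (episodes indexed from 0), given seed \<open>u\<close> and the
  weight sequence \<open>ws\<close>.\<close>
definition arms :: "'u policy \<Rightarrow> nat \<Rightarrow> nat set set \<Rightarrow> 'u \<Rightarrow> (nat \<Rightarrow> nat \<Rightarrow> real) \<Rightarrow> nat \<Rightarrow> nat set" where
  "arms \<pi> L \<I> u ws t = \<pi> L \<I> u (hist \<pi> L \<I> u ws t)"

definition sample_space :: "'u measure \<Rightarrow> (nat \<Rightarrow> real) measure \<Rightarrow> ('u \<times> (nat \<Rightarrow> nat \<Rightarrow> real)) measure" where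
  "sample_space U P = U \<Otimes>\<^sub>M PiM UNIV (\<lambda>_::nat. P)"

definition algorithm :: "'u measure \<Rightarrow> 'u policy \<Rightarrow> bool" where
  "algorithm U \<pi> \<longleftrightarrow> prob_space U \<and>
     (\<forall>L \<I> u h. matroid {1..L} \<I> \<longrightarrow> basis \<I> (\<pi> L \<I> u h)) \<and>
     (\<forall>L \<I> t. matroid {1..L} \<I> \<longrightarrow>
        (\<lambda>\<omega>. arms \<pi> L \<I> (fst \<omega>) (snd \<omega>) t)
          \<in> measurable (sample_space U (weight_space L)) (count_space UNIV))"

definition expected_pulls ::
  "'u measure \<Rightarrow> 'u policy \<Rightarrow> nat \<Rightarrow> nat set set \<Rightarrow> (nat \<Rightarrow> real) measure \<Rightarrow> nat \<Rightarrow> nat \<Rightarrow> real" where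
  "expected_pulls U \<pi> L \<I> P e n =
     (\<integral>\<omega>. real (card {t\<in>{..<n}. e \<in> arms \<pi> L \<I> (fst \<omega>) (snd \<omega>) t}) \<partial>sample_space U P)"

definition regret ::
  "'u measure \<Rightarrow> 'u policy \<Rightarrow> nat \<Rightarrow> nat set set \<Rightarrow> (nat \<Rightarrow> real) measure \<Rightarrow> nat \<Rightarrow> real" where
  "regret U \<pi> L \<I> P n =
     (\<integral>\<omega>. (\<Sum>t<n. (\<Sum>e\<in>opt_basis L \<I> P. snd \<omega> t e)
                  - (\<Sum>e\<in>arms \<pi> L \<I> (fst \<omega>) (snd \<omega>) t. snd \<omega> t e)) \<partial>sample_space U P)"

definition consistent :: "'u measure \<Rightarrow> 'u policy \<Rightarrow> bool" where
  "consistent U \<pi> \<longleftrightarrow>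
     (\<forall>L \<I> P. matroid {1..L} \<I> \<and> bandit_dist L P \<longrightarrow>
        (\<forall>e\<in>{1..L}. e \<notin> \<Union>(optimal_bases L \<I> P) \<longrightarrow>
           (\<forall>\<alpha>::real. \<alpha> > 0 \<longrightarrow>
              (\<lambda>n. expected_pulls U \<pi> L \<I> P e n) \<in> o(\<lambda>n. real n powr \<alpha>))))"

definition bernoulli_real :: "real \<Rightarrow> real measure" where
  "bernoulli_real p = distr (measure_pmf (bernoulli_pmf p)) borel (\<lambda>b. if b then 1 else 0)"

definition partition_indep :: "nat \<Rightarrow> nat \<Rightarrow> (nat \<Rightarrow> nat set) \<Rightarrow> nat set set" where
  "partition_indep L K B = {I. I \<subseteq> {1..L} \<and> (\<forall>k\<in>{1..K}. card (I \<inter> B k) \<le> 1)}"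

definition instance_mean :: "nat \<Rightarrow> (nat \<Rightarrow> nat set) \<Rightarrow> real \<Rightarrow> nat \<Rightarrow> real" where
  "instance_mean K B \<Delta> e = (if \<exists>k\<in>{1..K}. e \<in> B k \<and> e = Min (B k) then 1/2 else 1/2 - \<Delta>)"

definition instance_dist :: "nat \<Rightarrow> nat \<Rightarrow> (nat \<Rightarrow> nat set) \<Rightarrow> real \<Rightarrow> (nat \<Rightarrow> real) measure" where
  "instance_dist L K B \<Delta> = PiM {1..L} (\<lambda>e. bernoulli_real (instance_mean K B \<Delta> e))"

end

theory Submission
  imports Defs
begin

text \<open>
  Fix an item \<open>e\<close> that is not the minimum of its block and raise its mean to some \<open>q > 1/2\<close>. Under the
  new distribution all other items of the block are suboptimal, so a consistent algorithm neglects \<open>e\<close>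
  in only \<open>o(n\<^sup>\<alpha>)\<close> episodes, whereas under the original one it neglects \<open>e\<close> in all but \<open>o(n\<^sup>\<alpha>)\<close>
  episodes. Let \<open>Z\<close> be the likelihood ratio of the two environments on the observed history and \<open>X\<close> the
  fraction of episodes in which \<open>e\<close> is not chosen. Only the observed weights of \<open>e\<close> enter \<open>Z\<close>, so
  \<open>E[- ln Z] = E[T\<^sub>e(n)] kl\<close>, where \<open>kl \<le> (1/2 - \<Delta> - q)\<^sup>2 / (q (1 - q))\<close>. On the other hand,
  integrating a tangent-line bound for the logarithm gives
  \<open>E[- ln Z] \<ge> E[X] (1 + ln c) - c E[X Z] - 1\<close> for every \<open>c > 0\<close>, and \<open>E[X Z]\<close> is the mean of \<open>X\<close> in the
  new environment. With \<open>c = n\<^sup>1\<^sup>-\<^sup>\<alpha>\<close> this yields \<open>E[T\<^sub>e(n)] kl \<ge> (1 - \<alpha> - o(1)) ln n\<close>; now let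
  \<open>\<alpha> \<rightarrow> 0\<close> and \<open>q \<rightarrow> 1/2\<close>, where \<open>kl\<close> is at most \<open>4 \<Delta>\<^sup>2\<close> in the limit. Each such episode costs
  \<open>\<Delta>\<close> of regret, and there are \<open>L - K\<close> such items.
\<close>

subsection \<open>Resampling one coordinate\<close>

text \<open>Tonelli for the law of one coordinate and the law of the rest. If \<open>j\<close>
  already lies in \<open>I\<close>, the update overwrites that coordinate with a fresh independent
  sample, which is how resampling arises; if it lies outside, the lemma splits one coordinate
  off.\<close>

lemma nn_integral_PiM_insert:
  assumes "\<And>i. i \<in> I \<Longrightarrow> prob_space (M i)" and "prob_space (M j)"
    and f: "f \<in> borel_measurable (PiM (insert j I) M)"
  shows "(\<integral>\<^sup>+ X. f X \<partial>PiM (insert j I) M) = (\<integral>\<^sup>+ X. \<integral>\<^sup>+ x. f (X(j := x)) \<partial>M j \<partial>PiM I M)"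
proof -
  interpret Mj: prob_space "M j" by fact
  interpret PI: prob_space "PiM I M" using assms(1) by (rule prob_space_PiM)
  interpret pair_sigma_finite "M j" "PiM I M" ..
  have meas: "(\<lambda>(x, X). X(j := x)) \<in> measurable (M j \<Otimes>\<^sub>M PiM I M) (PiM (insert j I) M)"
    unfolding case_prod_beta by (intro measurable_fun_upd[where J=I]) auto
  have "(\<integral>\<^sup>+ X. f X \<partial>PiM (insert j I) M)
      = (\<integral>\<^sup>+ X. f X \<partial>distr (M j \<Otimes>\<^sub>M PiM I M) (PiM (insert j I) M) (\<lambda>(x, X). X(j := x)))"
    using distr_pair_PiM_eq_PiM[of I M j] assms(1,2) by simp
  also have "\<dots> = (\<integral>\<^sup>+ z. f ((\<lambda>(x, X). X(j := x)) z) \<partial>(M j \<Otimes>\<^sub>M PiM I M))"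
    by (rule nn_integral_distr[OF meas]) (use f in simp)
  also have "\<dots> = (\<integral>\<^sup>+ X. \<integral>\<^sup>+ x. f (X(j := x)) \<partial>M j \<partial>PiM I M)"
    using nn_integral_snd[of "\<lambda>z. f ((snd z)(j := fst z))"] measurable_compose[OF meas f]
    by (simp add: case_prod_beta)
  finally show ?thesis .
qed

lemma measurable_sample_space_update:
  "(\<lambda>z. (fst (fst z), (snd (fst z))(t := snd z)))
    \<in> measurable (sample_space U P \<Otimes>\<^sub>M P) (sample_space U P)"
  unfolding sample_space_def by (intro measurable_Pair measurable_fun_upd[where J=UNIV]) auto

lemma borel_measurable_resample_section:
  assumes "f \<in> borel_measurable (sample_space U P)" and "\<omega> \<in> space (sample_space U P)"
  shows "(\<lambda>w. f (fst \<omega>, (snd \<omega>)(t := w))) \<in> borel_measurable P"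
  using measurable_compose[OF measurable_Pair1'[OF assms(2)]
      measurable_compose[OF measurable_sample_space_update assms(1)]] by simp

lemma borel_measurable_resample:
  assumes "prob_space P" and f: "f \<in> borel_measurable (sample_space U P)"
  shows "(\<lambda>\<omega>. \<integral>\<^sup>+ w. f (fst \<omega>, (snd \<omega>)(t := w)) \<partial>P) \<in> borel_measurable (sample_space U P)"
proof -
  interpret P: prob_space P by fact
  show ?thesis
    using P.borel_measurable_nn_integral_fst[OF measurable_compose[OF measurable_sample_space_update f]]
    by simp
qed

text \<open>Replacing the weights of episode \<open>t\<close> by an independent copy preserves the
  law of the sample. This does the work of conditioning on the other episodes: whatever ignores the
  weights of \<open>t\<close> is constant in the inner integral.\<close>

lemma nn_integral_sample_space_resample:
  assumes "prob_space U" and "prob_space P"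
    and f: "f \<in> borel_measurable (sample_space U P)"
  shows "(\<integral>\<^sup>+ \<omega>. f \<omega> \<partial>sample_space U P)
    = (\<integral>\<^sup>+ \<omega>. \<integral>\<^sup>+ w. f (fst \<omega>, (snd \<omega>)(t := w)) \<partial>P \<partial>sample_space U P)"
proof -
  interpret U: prob_space U by fact
  interpret P: prob_space P by fact
  interpret PP: prob_space "PiM UNIV (\<lambda>_::nat. P)" using assms(2) by (intro prob_space_PiM)
  have f': "f \<in> borel_measurable (U \<Otimes>\<^sub>M PiM UNIV (\<lambda>_::nat. P))"
    using f by (simp add: sample_space_def)
  have g: "(\<lambda>\<omega>. \<integral>\<^sup>+ w. f (fst \<omega>, (snd \<omega>)(t := w)) \<partial>P)
      \<in> borel_measurable (U \<Otimes>\<^sub>M PiM UNIV (\<lambda>_::nat. P))"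
    using borel_measurable_resample[OF assms(2) f] by (simp add: sample_space_def)
  have "(\<integral>\<^sup>+ \<omega>. f \<omega> \<partial>sample_space U P)
      = (\<integral>\<^sup>+ u. \<integral>\<^sup>+ ws. f (u, ws) \<partial>PiM UNIV (\<lambda>_. P) \<partial>U)"
    unfolding sample_space_def by (rule PP.nn_integral_fst[symmetric, OF f'])
  also have "\<dots> = (\<integral>\<^sup>+ u. \<integral>\<^sup>+ ws. \<integral>\<^sup>+ w. f (u, ws(t := w)) \<partial>P \<partial>PiM UNIV (\<lambda>_. P) \<partial>U)"
  proof (rule nn_integral_cong)
    fix u assume "u \<in> space U"
    \<comment> \<open>Reading the index set as \<open>insert t UNIV\<close> invokes the splitting
      lemma with \<open>I = UNIV\<close>, so coordinate \<open>t\<close> is overwritten.\<close>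
    then have "(\<lambda>ws. f (u, ws)) \<in> borel_measurable (PiM (insert t UNIV) (\<lambda>_::nat. P))"
      using measurable_compose[OF measurable_Pair1' f'] by simp
    from nn_integral_PiM_insert[OF _ _ this] assms(2)
    show "(\<integral>\<^sup>+ ws. f (u, ws) \<partial>PiM UNIV (\<lambda>_. P))
        = (\<integral>\<^sup>+ ws. \<integral>\<^sup>+ w. f (u, ws(t := w)) \<partial>P \<partial>PiM UNIV (\<lambda>_. P))"
      by simp
  qed
  also have "\<dots> = (\<integral>\<^sup>+ \<omega>. \<integral>\<^sup>+ w. f (fst \<omega>, (snd \<omega>)(t := w)) \<partial>P \<partial>sample_space U P)"
    unfolding sample_space_def using PP.nn_integral_fst[OF g] by simp
  finally show ?thesis .
qed

lemma sets_sample_space_cong: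
  assumes "sets P = sets Q"
  shows "sets (sample_space U P) = sets (sample_space U Q)"
  unfolding sample_space_def using assms by (intro sets_pair_measure_cong sets_PiM_cong) auto

lemma prob_space_sample_space:
  assumes "prob_space U" and "prob_space P"
  shows "prob_space (sample_space U P)"
proof -
  interpret U: prob_space U by fact
  interpret PP: prob_space "PiM UNIV (\<lambda>_::nat. P)" using assms(2) by (intro prob_space_PiM)
  interpret pair_prob_space U "PiM UNIV (\<lambda>_::nat. P)" ..
  show ?thesis unfolding sample_space_def by unfold_locales
qed

section \<open>Causality of histories and choices\<close>

lemma hist_cong:
  "(\<And>s. s < t \<Longrightarrow> ws s = ws' s) \<Longrightarrow> hist \<pi> L \<I> u ws t = hist \<pi> L \<I> u ws' t"
  by (induction t) (simp_all add: Let_def)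

lemma hist_update [simp]: "t \<le> s \<Longrightarrow> hist \<pi> L \<I> u (ws(s := w)) t = hist \<pi> L \<I> u ws t"
  by (rule hist_cong) simp

lemma arms_update [simp]: "t \<le> s \<Longrightarrow> arms \<pi> L \<I> u (ws(s := w)) t = arms \<pi> L \<I> u ws t"
  by (simp add: arms_def)

lemma hist_Suc_eq: "hist \<pi> L \<I> u ws (Suc t)
    = hist \<pi> L \<I> u ws t @ [(arms \<pi> L \<I> u ws t, restrict (ws t) (arms \<pi> L \<I> u ws t))]"
  by (simp add: arms_def Let_def)

lemma length_hist [simp]: "length (hist \<pi> L \<I> u ws t) = t"
  by (induction t) (simp_all add: Let_def)

lemma hist_nth: "s < t \<Longrightarrow> hist \<pi> L \<I> u ws t ! s
    = (arms \<pi> L \<I> u ws s, restrict (ws s) (arms \<pi> L \<I> u ws s))"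
  by (induction t) (auto simp: Let_def nth_append less_Suc_eq arms_def)

text \<open>Pull counts are thereby functions of the history, which is the form of integrand that
  the change of measure accepts.\<close>

lemma arms_eq_if_hist_eq:
  assumes "hist \<pi> L \<I> u ws t = hist \<pi> L \<I> u ws' t" and "s < t"
  shows "arms \<pi> L \<I> u ws s = arms \<pi> L \<I> u ws' s"
  using hist_nth[OF assms(2), of \<pi> L \<I> u ws] hist_nth[OF assms(2), of \<pi> L \<I> u ws'] assms(1) by simp

subsection \<open>Product Bernoulli distributions\<close>

text \<open>Arbitrary means are allowed so that the given instance and its perturbation
  \<open>m(e := q)\<close> belong to one family.\<close>

definition bernoulli_product :: "nat \<Rightarrow> (nat \<Rightarrow> real) \<Rightarrow> (nat \<Rightarrow> real) measure" where
  "bernoulli_product L m = PiM {1..L} (\<lambda>e. bernoulli_real (m e))"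

lemma sets_bernoulli_real [simp, measurable_cong]: "sets (bernoulli_real p) = sets borel"
  by (simp add: bernoulli_real_def)

lemma space_bernoulli_real [simp]: "space (bernoulli_real p) = UNIV"
  by (simp add: bernoulli_real_def)

lemma prob_space_bernoulli_real: "prob_space (bernoulli_real p)"
  unfolding bernoulli_real_def
  by (intro prob_space.prob_space_distr measure_pmf.prob_space_axioms) simp

lemma nn_integral_bernoulli_real:
  assumes "0 \<le> p" "p \<le> 1" and f: "f \<in> borel_measurable borel"
  shows "(\<integral>\<^sup>+ x. f x \<partial>bernoulli_real p) = f 1 * ennreal p + f 0 * ennreal (1 - p)"
  using assms unfolding bernoulli_real_def by (simp add: nn_integral_distr)

lemma AE_bernoulli_real: "AE x in bernoulli_real p. x = 0 \<or> x = 1"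
  unfolding bernoulli_real_def by (subst AE_distr_iff) (auto intro: AE_I2)

lemma sets_bernoulli_product: "sets (bernoulli_product L m) = sets (weight_space L)"
  unfolding bernoulli_product_def weight_space_def by (intro sets_PiM_cong) auto

lemma prob_space_bernoulli_product: "prob_space (bernoulli_product L m)"
  unfolding bernoulli_product_def by (intro prob_space_PiM prob_space_bernoulli_real)

lemma AE_bernoulli_product:
  "e \<in> {1..L} \<Longrightarrow> AE w in bernoulli_product L m. w e = 0 \<or> w e = 1"
  unfolding bernoulli_product_def
  by (intro AE_PiM_component prob_space_bernoulli_real AE_bernoulli_real)

lemma bandit_dist_bernoulli_product: "bandit_dist L (bernoulli_product L m)"
  unfolding bandit_dist_def
proof (intro conjI)
  show "AE w in bernoulli_product L m. \<forall>e\<in>{1..L}. 0 \<le> w e \<and> w e \<le> 1"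
    by (intro AE_finite_allI) (auto intro: AE_mp[OF AE_bernoulli_product])
qed (simp_all add: sets_bernoulli_product prob_space_bernoulli_product)

lemma nn_integral_bernoulli_product_component:
  assumes "e \<in> {1..L}" "0 \<le> m e" "m e \<le> 1" and f: "f \<in> borel_measurable borel"
  shows "(\<integral>\<^sup>+ w. f (w e) \<partial>bernoulli_product L m) = f 1 * ennreal (m e) + f 0 * ennreal (1 - m e)"
proof -
  have "(\<integral>\<^sup>+ w. f (w e) \<partial>bernoulli_product L m)
      = (\<integral>\<^sup>+ x. f x \<partial>distr (bernoulli_product L m) (bernoulli_real (m e)) (\<lambda>w. w e))"
    using assms(1) f unfolding bernoulli_product_def
    by (subst nn_integral_distr) (auto intro: measurable_component_singleton)
  also have "distr (bernoulli_product L m) (bernoulli_real (m e)) (\<lambda>w. w e) = bernoulli_real (m e)"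
    unfolding bernoulli_product_def
    using distr_PiM_component[of "{1..L}" "\<lambda>e. bernoulli_real (m e)" e] assms(1)
    by (simp add: prob_space_bernoulli_real)
  finally show ?thesis using assms by (simp add: nn_integral_bernoulli_real)
qed

text \<open>Stated for integrands that do not look at coordinate \<open>e\<close> unless \<open>b\<close> holds: the
  likelihood ratio of \<open>e\<close> is only needed when \<open>e\<close> is observed.\<close>
lemma nn_integral_bernoulli_product_fun_upd:
  assumes e: "e \<in> {1..L}" and p: "0 < m e" "m e < 1" and q: "0 \<le> q" "q \<le> 1"
    and f: "f \<in> borel_measurable (weight_space L)"
    and indep: "\<And>w x. \<not> b \<Longrightarrow> f (w(e := x)) = f w"
  shows "(\<integral>\<^sup>+ w. f w \<partial>bernoulli_product L (m(e := q)))
    = (\<integral>\<^sup>+ w. f w * ennreal (if b then if w e = 1 then q / m e else (1 - q) / (1 - m e) else 1)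
        \<partial>bernoulli_product L m)"
proof -
  define r where "r x = ennreal (if b then if x = 1 then q / m e else (1 - q) / (1 - m e) else 1)"
    for x :: real
  have r[measurable]: "r \<in> borel_measurable borel" unfolding r_def by measurable
  define R where "R = PiM ({1..L} - {e}) (\<lambda>e. bernoulli_real (m e))"
  \<comment> \<open>For every value \<open>c\<close> the law splits into coordinate \<open>e\<close>
    and the same remaining product \<open>R\<close>, so the claim reduces to a one-dimensional
    identity for each \<open>w\<close> in \<open>R\<close>.\<close>
  have split: "(\<integral>\<^sup>+ w. g w \<partial>bernoulli_product L (m(e := c)))
      = (\<integral>\<^sup>+ w. \<integral>\<^sup>+ x. g (w(e := x)) \<partial>bernoulli_real c \<partial>R)"
    if g: "g \<in> borel_measurable (weight_space L)" for g c
  proof -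
    have "insert e ({1..L} - {e}) = {1..L}" using e by auto
    moreover have "PiM ({1..L} - {e}) (\<lambda>i. bernoulli_real ((m(e := c)) i)) = R"
      unfolding R_def by (intro PiM_cong) auto
    moreover have "g \<in> borel_measurable (bernoulli_product L (m(e := c)))"
      using g measurable_cong_sets[OF sets_bernoulli_product refl] by blast
    ultimately show ?thesis
      using nn_integral_PiM_insert[of "{1..L} - {e}" "\<lambda>i. bernoulli_real ((m(e := c)) i)" e g]
      by (simp add: bernoulli_product_def prob_space_bernoulli_real)
  qed
  have g: "(\<lambda>w. f w * r (w e)) \<in> borel_measurable (weight_space L)"
    using e f unfolding weight_space_def by measurable
  have "(\<integral>\<^sup>+ x. f (w(e := x)) \<partial>bernoulli_real q)
      = (\<integral>\<^sup>+ x. f (w(e := x)) * r x \<partial>bernoulli_real (m e))" if w: "w \<in> space R" for w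
  proof (cases b)
    case True
    have "(\<lambda>x. w(e := x)) \<in> measurable borel (weight_space L)"
      unfolding weight_space_def
      by (rule measurable_fun_upd[where J="{1..L} - {e}"])
         (use e w in \<open>auto simp: R_def space_PiM PiE_def extensional_def\<close>)
    from measurable_compose[OF this f]
    have [measurable]: "(\<lambda>x. f (w(e := x))) \<in> borel_measurable borel" .
    \<comment> \<open>At the two atoms the ratio turns the old masses into the new ones.\<close>
    have "ennreal (q / m e) * ennreal (m e) = ennreal q"
      "ennreal ((1 - q) / (1 - m e)) * ennreal (1 - m e) = ennreal (1 - q)"
      using p q by (simp_all flip: ennreal_mult'')
    then show ?thesis using True p q
      by (simp add: nn_integral_bernoulli_real r_def mult.assoc)
  next
    \<comment> \<open>Without an observation the integrand is constant in \<open>x\<close>, and both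
      Bernoulli laws have total mass one.\<close>
    case False
    then show ?thesis using indep p q
      by (simp add: r_def prob_space.emeasure_space_1[OF prob_space_bernoulli_real, simplified])
  qed
  then have "(\<integral>\<^sup>+ w. f w \<partial>bernoulli_product L (m(e := q)))
      = (\<integral>\<^sup>+ w. \<integral>\<^sup>+ x. f (w(e := x)) * r x \<partial>bernoulli_real (m e) \<partial>R)"
    unfolding split[OF f] by (rule nn_integral_cong)
  also have "\<dots> = (\<integral>\<^sup>+ w. f w * r (w e) \<partial>bernoulli_product L m)"
    using split[OF g, of "m e"] by simp
  finally show ?thesis unfolding r_def .
qed

subsection \<open>Change of measure for a matroid bandit\<close>

locale matroid_algorithm =
  fixes U :: "'u measure" and \<pi> :: "'u policy" and L :: nat and \<I> :: "nat set set"
  assumes algorithm: "algorithm U \<pi>" and matroid: "matroid {1..L} \<I>"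
begin

abbreviation arm :: "'u \<times> (nat \<Rightarrow> nat \<Rightarrow> real) \<Rightarrow> nat \<Rightarrow> nat set" where
  "arm \<omega> t \<equiv> arms \<pi> L \<I> (fst \<omega>) (snd \<omega>) t"

abbreviation bernoulli_sample :: "(nat \<Rightarrow> real) \<Rightarrow> ('u \<times> (nat \<Rightarrow> nat \<Rightarrow> real)) measure" where
  "bernoulli_sample m \<equiv> sample_space U (bernoulli_product L m)"

lemma prob_space_U: "prob_space U"
  using algorithm by (simp add: algorithm_def)

sublocale sample: prob_space "bernoulli_sample m" for m
  by (intro prob_space_sample_space prob_space_U prob_space_bernoulli_product)

lemma basis_arm: "basis \<I> (arm \<omega> t)"
  using algorithm matroid by (simp add: algorithm_def arms_def)

lemma arm_subset: "arm \<omega> t \<subseteq> {1..L}"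
  using basis_arm[of \<omega> t] matroid by (auto simp: basis_def matroid_def)

lemma sets_bernoulli_sample [measurable_cong]:
  "sets (bernoulli_sample m) = sets (sample_space U (weight_space L))"
  by (intro sets_sample_space_cong sets_bernoulli_product)

lemma pred_mem_arm [measurable]:
  "Measurable.pred (sample_space U (weight_space L)) (\<lambda>\<omega>. e \<in> arm \<omega> t)"
proof -
  have "(\<lambda>\<omega>. arm \<omega> t) \<in> measurable (sample_space U (weight_space L)) (count_space UNIV)"
    using algorithm matroid by (simp add: algorithm_def)
  then show ?thesis by (rule measurable_compose) simp
qed

lemma measurable_weight [measurable (raw)]:
  assumes "e \<in> {1..L}"
  shows "(\<lambda>\<omega>. snd \<omega> t e) \<in> borel_measurable (sample_space U (weight_space L))"
proof -
  have "(\<lambda>\<omega>. snd \<omega> t) \<in> measurable (sample_space U (weight_space L)) (weight_space L)"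
    unfolding sample_space_def by measurable
  then show ?thesis
    unfolding weight_space_def
    by (rule measurable_compose) (use assms in \<open>auto intro: measurable_component_singleton\<close>)
qed

lemma AE_bernoulli_sample:
  assumes e: "e \<in> {1..L}"
  shows "AE \<omega> in bernoulli_sample m. snd \<omega> t e = 0 \<or> snd \<omega> t e = 1"
proof -
  interpret U: prob_space U by (rule prob_space_U)
  interpret PP: prob_space "PiM UNIV (\<lambda>_::nat. bernoulli_product L m)"
    by (intro prob_space_PiM prob_space_bernoulli_product)
  interpret pair_sigma_finite U "PiM UNIV (\<lambda>_::nat. bernoulli_product L m)" ..
  have "Measurable.pred (bernoulli_sample m) (\<lambda>\<omega>. snd \<omega> t e = 0 \<or> snd \<omega> t e = 1)"
    using e by measurable
  then have "{\<omega> \<in> space (bernoulli_sample m). snd \<omega> t e = 0 \<or> snd \<omega> t e = 1} \<in> sets (bernoulli_sample m)"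
    by (simp add: pred_def)
  moreover have "AE u in U. AE ws in PiM UNIV (\<lambda>_. bernoulli_product L m). ws t e = 0 \<or> ws t e = 1"
    using AE_PiM_component[of UNIV "\<lambda>_. bernoulli_product L m" t "\<lambda>w. w e = 0 \<or> w e = 1"]
      AE_bernoulli_product[OF e] prob_space_bernoulli_product by simp
  ultimately show ?thesis
    unfolding sample_space_def by (intro AE_pair_measure) auto
qed

text \<open>Density of the history of length \<open>n\<close> under \<open>m(e := q)\<close>
  relative to \<open>m\<close>. The seed, the choices given the past and the weights of other items
  have the same law in both environments and cancel. Weights are almost surely 0 or 1, so one test
  for 1 separates the two atoms.\<close>

definition likelihood_ratio ::
    "(nat \<Rightarrow> real) \<Rightarrow> nat \<Rightarrow> real \<Rightarrow> nat \<Rightarrow> 'u \<times> (nat \<Rightarrow> nat \<Rightarrow> real) \<Rightarrow> real" where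
  "likelihood_ratio m e q n \<omega> =
     (\<Prod>t<n. if e \<in> arm \<omega> t then if snd \<omega> t e = 1 then q / m e else (1 - q) / (1 - m e) else 1)"

lemma measurable_likelihood_ratio [measurable (raw)]:
  "e \<in> {1..L} \<Longrightarrow> likelihood_ratio m e q n \<in> borel_measurable (sample_space U (weight_space L))"
  unfolding likelihood_ratio_def by measurable

text \<open>The likelihood ratio involves only the observed weights of \<open>e\<close> because the integrand is a
  function of the history. One episode is peeled off at a time by resampling its weight vector.\<close>
lemma nn_integral_change_of_measure:
  assumes e: "e \<in> {1..L}" and p: "0 < m e" "m e < 1" and q: "0 \<le> q" "q \<le> 1"
    and "G \<in> borel_measurable (sample_space U (weight_space L))"
    and "\<And>u ws ws'. hist \<pi> L \<I> u ws n = hist \<pi> L \<I> u ws' n \<Longrightarrow> G (u, ws) = G (u, ws')"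
  shows "(\<integral>\<^sup>+ \<omega>. G \<omega> \<partial>bernoulli_sample (m(e := q)))
    = (\<integral>\<^sup>+ \<omega>. G \<omega> * ennreal (likelihood_ratio m e q n \<omega>) \<partial>bernoulli_sample m)"
  using assms(6,7)
proof (induction n arbitrary: G)
  case 0
  \<comment> \<open>All histories of length 0 coincide, so \<open>G\<close> cannot depend on the
    weights and \<open>undefined\<close> may stand in for them.\<close>
  define g where "g u = G (u, undefined)" for u
  have "G \<omega> = g (fst \<omega>)" for \<omega>
    unfolding g_def using 0(2)[of "fst \<omega>" "snd \<omega>" undefined] by simp
  then have G: "G = (\<lambda>\<omega>. g (fst \<omega>))" by (rule ext)
  have "(\<integral>\<^sup>+ \<omega>. G \<omega> \<partial>bernoulli_sample k) = (\<integral>\<^sup>+ u. g u \<partial>U)" for k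
  proof -
    interpret PP: prob_space "PiM UNIV (\<lambda>_::nat. bernoulli_product L k)"
      by (intro prob_space_PiM prob_space_bernoulli_product)
    have "G \<in> borel_measurable (bernoulli_sample k)" using 0(1) by measurable
    then have "G \<in> borel_measurable (U \<Otimes>\<^sub>M PiM UNIV (\<lambda>_::nat. bernoulli_product L k))"
      by (simp add: sample_space_def)
    from PP.nn_integral_fst[OF this] show ?thesis
      by (simp add: sample_space_def G PP.emeasure_space_1)
  qed
  then show ?case by (simp add: likelihood_ratio_def)
next
  case (Suc n)
  let ?P = "bernoulli_product L m" and ?P' = "bernoulli_product L (m(e := q))"
  \<comment> \<open>\<open>G'\<close> averages the last episode under the new law and depends only
    on the history of length \<open>n\<close>, so the induction hypothesis applies to it.\<close>
  define G' where "G' \<omega> = (\<integral>\<^sup>+ w. G (fst \<omega>, (snd \<omega>)(n := w)) \<partial>?P')" for \<omega>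
  define r where "r \<omega> w = (if e \<in> arm \<omega> n then if w e = 1 then q / m e else (1 - q) / (1 - m e) else 1)"
    for \<omega> and w :: "nat \<Rightarrow> real"
  have r0: "r \<omega> w \<ge> 0" for \<omega> w using p q by (simp add: r_def)
  have G_meas: "G \<in> borel_measurable (bernoulli_sample k)" for k
    using Suc.prems(1) by measurable
  have GL_meas: "(\<lambda>\<omega>. G \<omega> * ennreal (likelihood_ratio m e q (Suc n) \<omega>)) \<in> borel_measurable (bernoulli_sample m)"
    using G_meas e by measurable
  have step: "(\<integral>\<^sup>+ w. G (fst \<omega>, (snd \<omega>)(n := w)) \<partial>?P')
      = (\<integral>\<^sup>+ w. G (fst \<omega>, (snd \<omega>)(n := w)) * ennreal (r \<omega> w) \<partial>?P)"
    if \<omega>: "\<omega> \<in> space (bernoulli_sample m)" for \<omega>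
    unfolding r_def
  proof (rule nn_integral_bernoulli_product_fun_upd[where m=m and e=e, OF e p q])
    show "(\<lambda>w. G (fst \<omega>, (snd \<omega>)(n := w))) \<in> borel_measurable (weight_space L)"
      using borel_measurable_resample_section[OF G_meas \<omega>] measurable_cong_sets[OF sets_bernoulli_product refl]
      by blast
    \<comment> \<open>If \<open>e\<close> is not chosen, the restriction stored in the history drops
      coordinate \<open>e\<close>.\<close>
    show "G (fst \<omega>, (snd \<omega>)(n := w(e := x))) = G (fst \<omega>, (snd \<omega>)(n := w))"
      if "e \<notin> arm \<omega> n" for w x
    proof (rule Suc.prems(2))
      show "hist \<pi> L \<I> (fst \<omega>) ((snd \<omega>)(n := w(e := x))) (Suc n)
          = hist \<pi> L \<I> (fst \<omega>) ((snd \<omega>)(n := w)) (Suc n)"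
        unfolding hist_Suc_eq hist_update[OF order_refl] arms_update[OF order_refl]
        using that by (simp add: restrict_fupd)
    qed
  qed
  have "(\<integral>\<^sup>+ \<omega>. G \<omega> \<partial>bernoulli_sample (m(e := q))) = (\<integral>\<^sup>+ \<omega>. G' \<omega> \<partial>bernoulli_sample (m(e := q)))"
    unfolding G'_def
    by (rule nn_integral_sample_space_resample[OF prob_space_U prob_space_bernoulli_product G_meas])
  also have "\<dots> = (\<integral>\<^sup>+ \<omega>. G' \<omega> * ennreal (likelihood_ratio m e q n \<omega>) \<partial>bernoulli_sample m)"
  proof (rule Suc.IH)
    have "G' \<in> borel_measurable (bernoulli_sample (m(e := q)))"
      unfolding G'_def by (intro borel_measurable_resample prob_space_bernoulli_product G_meas)
    then show "G' \<in> borel_measurable (sample_space U (weight_space L))"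
      using measurable_cong_sets[OF sets_bernoulli_sample refl] by blast
    show "G' (u, ws) = G' (u, ws')" if "hist \<pi> L \<I> u ws n = hist \<pi> L \<I> u ws' n" for u ws ws'
    proof -
      \<comment> \<open>Equal histories force the same choice in episode \<open>n\<close>; inserting
        the same \<open>w\<close> there extends them equally.\<close>
      have "hist \<pi> L \<I> u (ws(n := w)) (Suc n) = hist \<pi> L \<I> u (ws'(n := w)) (Suc n)" for w
        unfolding hist_Suc_eq hist_update[OF order_refl] arms_update[OF order_refl]
        using that by (simp add: arms_def)
      then show ?thesis
        unfolding G'_def by (metis Suc.prems(2) fst_conv snd_conv)
    qed
  qed
  also have "\<dots> = (\<integral>\<^sup>+ \<omega>. \<integral>\<^sup>+ w. G (fst \<omega>, (snd \<omega>)(n := w))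
        * ennreal (likelihood_ratio m e q (Suc n) (fst \<omega>, (snd \<omega>)(n := w))) \<partial>?P \<partial>bernoulli_sample m)"
  proof (rule nn_integral_cong)
    fix \<omega> assume \<omega>: "\<omega> \<in> space (bernoulli_sample m)"
    \<comment> \<open>Choices up to and including episode \<open>n\<close> ignore the weights of
      that episode, so the resampled vector enters only the last factor.\<close>
    have lr: "likelihood_ratio m e q (Suc n) (fst \<omega>, (snd \<omega>)(n := w)) = r \<omega> w * likelihood_ratio m e q n \<omega>"
      for w
    proof -
      have "likelihood_ratio m e q n (fst \<omega>, (snd \<omega>)(n := w)) = likelihood_ratio m e q n \<omega>"
        unfolding likelihood_ratio_def by (intro prod.cong) auto
      then show ?thesis by (simp add: likelihood_ratio_def r_def mult.commute)
    qed
    have "(\<lambda>w. w e) \<in> borel_measurable ?P"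
      using e measurable_cong_sets[OF sets_bernoulli_product refl]
      unfolding weight_space_def by (metis measurable_component_singleton)
    then have [measurable]: "r \<omega> \<in> borel_measurable ?P" unfolding r_def by measurable
    note [measurable] = borel_measurable_resample_section[OF G_meas \<omega>]
    have "G' \<omega> * ennreal (likelihood_ratio m e q n \<omega>)
       = (\<integral>\<^sup>+ w. G (fst \<omega>, (snd \<omega>)(n := w)) * ennreal (r \<omega> w) * ennreal (likelihood_ratio m e q n \<omega>) \<partial>?P)"
      unfolding G'_def step[OF \<omega>] by (rule nn_integral_multc[symmetric]) measurable
    then show "G' \<omega> * ennreal (likelihood_ratio m e q n \<omega>) = (\<integral>\<^sup>+ w. G (fst \<omega>, (snd \<omega>)(n := w))
        * ennreal (likelihood_ratio m e q (Suc n) (fst \<omega>, (snd \<omega>)(n := w))) \<partial>?P)"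
      by (simp add: lr r0 ennreal_mult' mult.assoc)
  qed
  also have "\<dots> = (\<integral>\<^sup>+ \<omega>. G \<omega> * ennreal (likelihood_ratio m e q (Suc n) \<omega>) \<partial>bernoulli_sample m)"
    by (rule nn_integral_sample_space_resample[OF prob_space_U prob_space_bernoulli_product GL_meas, symmetric])
  finally show ?case .
qed

text \<open>Here \<open>Q\<close> stands for an event that does not depend on the weights of episode \<open>t\<close>, such as
  the choice of an item in that episode.\<close>
lemma integral_weight_on:
  assumes e: "e \<in> {1..L}" and p: "0 \<le> m e" "m e \<le> 1"
    and [measurable]: "Measurable.pred (sample_space U (weight_space L)) Q"
    and Q: "\<And>\<omega> w. Q (fst \<omega>, (snd \<omega>)(t := w)) = Q \<omega>"
  shows "(\<integral>\<omega>. (if Q \<omega> then snd \<omega> t e else 0) \<partial>bernoulli_sample m)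
    = m e * sample.prob m {\<omega> \<in> space (bernoulli_sample m). Q \<omega>}"
proof -
  let ?f = "\<lambda>\<omega>. if Q \<omega> then snd \<omega> t e else 0"
  have [measurable]: "?f \<in> borel_measurable (bernoulli_sample m)" using e by measurable
  have "AE \<omega> in bernoulli_sample m. 0 \<le> ?f \<omega>"
    using AE_bernoulli_sample[OF e, where m=m and t=t] by eventually_elim auto
  then have "(\<integral>\<omega>. ?f \<omega> \<partial>bernoulli_sample m) = enn2real (\<integral>\<^sup>+ \<omega>. ennreal (?f \<omega>) \<partial>bernoulli_sample m)"
    by (intro integral_eq_nn_integral) simp_all
  \<comment> \<open>After resampling episode \<open>t\<close>, \<open>Q\<close> is constant in the
    fresh vector and the inner integral is the mean of one Bernoulli weight.\<close>
  also have "(\<integral>\<^sup>+ \<omega>. ennreal (?f \<omega>) \<partial>bernoulli_sample m)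
      = (\<integral>\<^sup>+ \<omega>. \<integral>\<^sup>+ w. ennreal (if Q \<omega> then w e else 0) \<partial>bernoulli_product L m \<partial>bernoulli_sample m)"
    by (subst nn_integral_sample_space_resample[OF prob_space_U prob_space_bernoulli_product, where t=t])
      (simp_all add: Q cong: if_cong)
  also have "\<dots> = (\<integral>\<^sup>+ \<omega>. ennreal (m e) * indicator {\<omega> \<in> space (bernoulli_sample m). Q \<omega>} \<omega>
      \<partial>bernoulli_sample m)"
    using nn_integral_bernoulli_product_component[where m=m and e=e and f=ennreal, OF e p]
    by (intro nn_integral_cong) (simp add: indicator_def)
  also have "\<dots> = ennreal (m e) * emeasure (bernoulli_sample m) {\<omega> \<in> space (bernoulli_sample m). Q \<omega>}"
    by (rule nn_integral_cmult_indicator) measurable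
  finally show ?thesis using p by (simp add: enn2real_mult measure_def)
qed

lemma integrable_fun_on:
  fixes h :: "real \<Rightarrow> real"
  assumes e: "e \<in> {1..L}" and [measurable]: "h \<in> borel_measurable borel"
    and [measurable]: "Measurable.pred (sample_space U (weight_space L)) Q"
  shows "integrable (bernoulli_sample m) (\<lambda>\<omega>. if Q \<omega> then h (snd \<omega> t e) else 0)"
proof (rule sample.integrable_const_bound)
  show "AE \<omega> in bernoulli_sample m. norm (if Q \<omega> then h (snd \<omega> t e) else 0) \<le> \<bar>h 0\<bar> + \<bar>h 1\<bar>"
    using AE_bernoulli_sample[OF e, where m=m and t=t] by eventually_elim auto
  show "(\<lambda>\<omega>. if Q \<omega> then h (snd \<omega> t e) else 0) \<in> borel_measurable (bernoulli_sample m)"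
    using e by measurable
qed

text \<open>On weights 0 and 1 every function is affine, \<open>h x = h 0 + (h 1 - h 0) * x\<close>,
  which reduces the claim to the mean of the weight.\<close>

lemma integral_fun_on:
  fixes h :: "real \<Rightarrow> real"
  assumes e: "e \<in> {1..L}" and p: "0 \<le> m e" "m e \<le> 1" and [measurable]: "h \<in> borel_measurable borel"
    and [measurable]: "Measurable.pred (sample_space U (weight_space L)) Q"
    and Q: "\<And>\<omega> w. Q (fst \<omega>, (snd \<omega>)(t := w)) = Q \<omega>"
  shows "(\<integral>\<omega>. (if Q \<omega> then h (snd \<omega> t e) else 0) \<partial>bernoulli_sample m)
    = (m e * h 1 + (1 - m e) * h 0) * sample.prob m {\<omega> \<in> space (bernoulli_sample m). Q \<omega>}"
proof -
  let ?A = "{\<omega> \<in> space (bernoulli_sample m). Q \<omega>}"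
  have [measurable]: "?A \<in> sets (bernoulli_sample m)" by measurable
  have "(\<integral>\<omega>. (if Q \<omega> then h (snd \<omega> t e) else 0) \<partial>bernoulli_sample m)
      = (\<integral>\<omega>. h 0 * indicator ?A \<omega> + (h 1 - h 0) * (if Q \<omega> then snd \<omega> t e else 0) \<partial>bernoulli_sample m)"
  proof (rule integral_cong_AE)
    show "AE \<omega> in bernoulli_sample m. (if Q \<omega> then h (snd \<omega> t e) else 0)
        = h 0 * indicator ?A \<omega> + (h 1 - h 0) * (if Q \<omega> then snd \<omega> t e else 0)"
      using AE_bernoulli_sample[OF e, where m=m and t=t] AE_space by eventually_elim auto
  qed (use e in measurable)
  also have "\<dots> = h 0 * sample.prob m ?A + (h 1 - h 0) * (m e * sample.prob m ?A)"
    using integrable_fun_on[OF e, where h="\<lambda>x. x" and m=m and t=t and Q=Q]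
      integral_weight_on[of e m Q t] e p Q
    by (subst Bochner_Integration.integral_add) (auto simp: sample.emeasure_eq_measure)
  finally show ?thesis by (simp add: algebra_simps)
qed

end

subsection \<open>Information lower bound\<close>

text \<open>The purely asymptotic part. Here \<open>a\<close> counts pulls of the item in the
  original environment, \<open>b\<close> counts episodes without it in the perturbed one, and
  \<open>\<kappa>\<close> bounds the information per pull.\<close>

lemma eventually_log_lower_bound:
  fixes a b :: "nat \<Rightarrow> real"
  assumes a: "\<And>\<alpha>. \<alpha> > 0 \<Longrightarrow> a \<in> o(\<lambda>n. real n powr \<alpha>)"
    and b: "\<And>\<alpha>. \<alpha> > 0 \<Longrightarrow> b \<in> o(\<lambda>n. real n powr \<alpha>)"
    and bound: "\<And>n c. n > 0 \<Longrightarrow> c > 0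
      \<Longrightarrow> (1 - a n / real n) * (1 + ln c) - c * (b n / real n) - 1 \<le> a n * \<kappa>"
    and \<kappa>: "\<kappa> > 0" and y: "y * \<kappa> < 1"
  shows "eventually (\<lambda>n. y * ln (real n) < a n) sequentially"
proof -
  \<comment> \<open>Half of the slack in \<open>y * \<kappa> < 1\<close> keeps
    \<open>y * \<kappa>\<close> strictly below \<open>1 - \<alpha>\<close>; the cap 1/2 keeps
    \<open>\<alpha>\<close> below 1 when \<open>y\<close> is negative.\<close>
  define \<alpha> where "\<alpha> = min (1/2) ((1 - y * \<kappa>) / 2)"
  have \<alpha>: "0 < \<alpha>" "\<alpha> < 1" "y * \<kappa> < 1 - \<alpha>" using y by (auto simp: \<alpha>_def min_def field_simps)
  have "(\<lambda>n. a n / real n powr 1) \<longlonglongrightarrow> 0" using a[of 1] by (intro smalloD_tendsto) auto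
  then have a0: "(\<lambda>n. a n / real n) \<longlonglongrightarrow> 0"
    by (rule Lim_transform_eventually) (auto intro!: eventually_mono[OF eventually_gt_at_top[of 0]])
  have b0: "(\<lambda>n. b n / real n powr \<alpha>) \<longlonglongrightarrow> 0" using b[OF \<alpha>(1)] by (rule smalloD_tendsto)
  have ln0: "(\<lambda>n. 1 / ln (real n)) \<longlonglongrightarrow> 0"
    by (rule real_tendsto_divide_at_top[OF tendsto_const filterlim_compose[OF ln_at_top filterlim_real_sequentially]])
  have "(\<lambda>n. (1 - a n / real n) * (1 / ln (real n) + (1 - \<alpha>))
      - b n / real n powr \<alpha> * (1 / ln (real n)) - 1 / ln (real n))
    \<longlonglongrightarrow> (1 - 0) * (0 + (1 - \<alpha>)) - 0 * 0 - 0"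
    by (intro tendsto_intros a0 b0 ln0)
  then have "eventually (\<lambda>n. y * \<kappa> < (1 - a n / real n) * (1 / ln (real n) + (1 - \<alpha>))
      - b n / real n powr \<alpha> * (1 / ln (real n)) - 1 / ln (real n)) sequentially"
    using \<alpha>(3) by (intro order_tendstoD) auto
  then show ?thesis using eventually_gt_at_top[of 1]
  proof eventually_elim
    case (elim n)
    have ln: "ln (real n) > 0" using elim by simp
    \<comment> \<open>With this \<open>c\<close> the term in \<open>b\<close> becomes
      \<open>b n / n powr \<alpha>\<close>, which vanishes, while \<open>ln c\<close> still
      contributes \<open>(1 - \<alpha>) * ln n\<close>.\<close>
    define c where "c = real n powr (1 - \<alpha>)"
    have c: "c > 0" "ln c = (1 - \<alpha>) * ln (real n)" "c / real n = 1 / real n powr \<alpha>"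
      using elim by (simp_all add: c_def ln_powr) (simp add: powr_diff)
    have "y * \<kappa> * ln (real n) < ((1 - a n / real n) * (1 / ln (real n) + (1 - \<alpha>))
      - b n / real n powr \<alpha> * (1 / ln (real n)) - 1 / ln (real n)) * ln (real n)"
      using elim ln by (intro mult_strict_right_mono) auto
    also have "\<dots> = (1 - a n / real n) * (1 + ln c) - (c / real n) * b n - 1"
      unfolding c(2,3) using ln by (simp add: field_simps)
    also have "\<dots> \<le> a n * \<kappa>" using bound[of n c] elim c(1) by simp
    finally show ?case using \<kappa> by (simp add: mult.commute mult.left_commute)
  qed
qed

text \<open>Applying \<open>ln x \<le> x - 1\<close> to both logarithms bounds the relative entropy
  by the chi-square divergence, a rational function whose limit in \<open>q\<close> is
  immediate.\<close>

lemma bernoulli_kl_le: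
  fixes p q :: real
  assumes "0 < p" "p < 1" "0 < q" "q < 1"
  shows "p * ln (p / q) + (1 - p) * ln ((1 - p) / (1 - q)) \<le> (p - q)\<^sup>2 / (q * (1 - q))"
proof -
  have "p * ln (p / q) + (1 - p) * ln ((1 - p) / (1 - q))
      \<le> p * (p / q - 1) + (1 - p) * ((1 - p) / (1 - q) - 1)"
    using assms by (intro add_mono mult_left_mono ln_le_minus_one) auto
  also have "\<dots> = (p - q)\<^sup>2 / (q * (1 - q))"
    using assms by (simp add: field_simps power2_eq_square)
  finally show ?thesis .
qed

text \<open>Tangent-line inequality behind the entropy bound: \<open>z\<close> is a likelihood ratio and \<open>x\<close> the
  fraction of episodes without the item.\<close>
lemma neg_ln_ge:
  fixes x z c :: real
  assumes "0 \<le> x" "x \<le> 1" "0 < z" "0 < c"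
  shows "x * (1 + ln c) - c * (x * z) + (1 - x) - (1 - x) * z \<le> - ln z"
proof -
  \<comment> \<open>Tangents to \<open>ln z\<close> at \<open>1 / c\<close> and at \<open>1\<close>;
    they are mixed with weights \<open>x\<close> and \<open>1 - x\<close>.\<close>
  have "ln (c * z) \<le> c * z - 1" "ln z \<le> z - 1" using assms by (intro ln_le_minus_one; simp)+
  then have "1 + ln c - c * z \<le> - ln z" "1 - z \<le> - ln z"
    using assms by (auto simp: ln_mult)
  then have "x * (1 + ln c - c * z) \<le> x * (- ln z)" "(1 - x) * (1 - z) \<le> (1 - x) * (- ln z)"
    using assms by (intro mult_left_mono; simp)+
  then show ?thesis by (simp add: algebra_simps)
qed

section \<open>Pull counts and the information they carry\<close>

context matroid_algorithm
begin

abbreviation mean_pulls :: "(nat \<Rightarrow> real) \<Rightarrow> nat \<Rightarrow> nat \<Rightarrow> real" where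
  "mean_pulls m e n \<equiv> expected_pulls U \<pi> L \<I> (bernoulli_product L m) e n"

definition pulls :: "nat \<Rightarrow> nat \<Rightarrow> 'u \<times> (nat \<Rightarrow> nat \<Rightarrow> real) \<Rightarrow> real" where
  "pulls e n \<omega> = real (card {t\<in>{..<n}. e \<in> arm \<omega> t})"

lemma pulls_eq_sum: "pulls e n \<omega> = (\<Sum>t<n. if e \<in> arm \<omega> t then 1 else 0)"
  by (simp add: pulls_def sum.If_cases Int_def)

lemma pulls_nonneg: "0 \<le> pulls e n \<omega>"
  by (simp add: pulls_def)

lemma pulls_le: "pulls e n \<omega> \<le> real n"
  using card_mono[of "{..<n}" "{t\<in>{..<n}. e \<in> arm \<omega> t}"] by (auto simp: pulls_def)

lemma measurable_pulls [measurable]: "pulls e n \<in> borel_measurable (sample_space U (weight_space L))"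
  unfolding pulls_eq_sum[abs_def] by measurable

lemma integrable_pulls: "integrable (bernoulli_sample m) (pulls e n)"
  by (rule sample.integrable_const_bound[where B="real n"]) (simp_all add: pulls_nonneg pulls_le)

lemma mean_pulls_eq: "mean_pulls m e n = (\<integral>\<omega>. pulls e n \<omega> \<partial>bernoulli_sample m)"
  by (simp add: expected_pulls_def pulls_def)

lemma mean_pulls_eq_sum:
  "mean_pulls m e n = (\<Sum>t<n. sample.prob m {\<omega> \<in> space (bernoulli_sample m). e \<in> arm \<omega> t})"
proof -
  have "(\<integral>\<omega>. pulls e n \<omega> \<partial>bernoulli_sample m)
      = (\<Sum>t<n. \<integral>\<omega>. (if e \<in> arm \<omega> t then 1 else 0) \<partial>bernoulli_sample m)"
    unfolding pulls_eq_sum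
    by (intro Bochner_Integration.integral_sum sample.integrable_const_bound[where B=1]) auto
  also have "\<dots> = (\<Sum>t<n. \<integral>\<omega>. indicator {\<omega> \<in> space (bernoulli_sample m). e \<in> arm \<omega> t} \<omega>
      \<partial>bernoulli_sample m)"
    by (intro sum.cong Bochner_Integration.integral_cong) auto
  finally show ?thesis by (simp add: mean_pulls_eq)
qed

lemma has_bochner_integral_change_of_measure:
  assumes e: "e \<in> {1..L}" and p: "0 < m e" "m e < 1" and q: "0 \<le> q" "q \<le> 1"
    and G[measurable]: "G \<in> borel_measurable (sample_space U (weight_space L))"
    and dep: "\<And>u ws ws'. hist \<pi> L \<I> u ws n = hist \<pi> L \<I> u ws' n \<Longrightarrow> G (u, ws) = G (u, ws')"
    and int: "integrable (bernoulli_sample (m(e := q))) G" and G0: "\<And>\<omega>. 0 \<le> (G \<omega> :: real)"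
  shows "has_bochner_integral (bernoulli_sample m) (\<lambda>\<omega>. G \<omega> * likelihood_ratio m e q n \<omega>)
    (\<integral>\<omega>. G \<omega> \<partial>bernoulli_sample (m(e := q)))"
proof (rule has_bochner_integral_nn_integral)
  have lr0: "0 \<le> likelihood_ratio m e q n \<omega>" for \<omega>
    using p q by (auto simp: likelihood_ratio_def intro!: prod_nonneg)
  show "(\<lambda>\<omega>. G \<omega> * likelihood_ratio m e q n \<omega>) \<in> borel_measurable (bernoulli_sample m)"
    using e by measurable
  show "AE \<omega> in bernoulli_sample m. 0 \<le> G \<omega> * likelihood_ratio m e q n \<omega>"
    using lr0 G0 by simp
  show "0 \<le> (\<integral>\<omega>. G \<omega> \<partial>bernoulli_sample (m(e := q)))" using G0 by simp
  have "(\<integral>\<^sup>+ \<omega>. ennreal (G \<omega> * likelihood_ratio m e q n \<omega>) \<partial>bernoulli_sample m)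
      = (\<integral>\<^sup>+ \<omega>. ennreal (G \<omega>) * ennreal (likelihood_ratio m e q n \<omega>) \<partial>bernoulli_sample m)"
    using lr0 G0 by (simp add: ennreal_mult)
  also have "\<dots> = (\<integral>\<^sup>+ \<omega>. ennreal (G \<omega>) \<partial>bernoulli_sample (m(e := q)))"
    by (rule nn_integral_change_of_measure[symmetric, where m=m and e=e, OF e p q])
      (auto dest: dep)
  also have "\<dots> = ennreal (\<integral>\<omega>. G \<omega> \<partial>bernoulli_sample (m(e := q)))"
    using int G0 by (intro nn_integral_eq_integral) auto
  finally show "(\<integral>\<^sup>+ \<omega>. ennreal (G \<omega> * likelihood_ratio m e q n \<omega>) \<partial>bernoulli_sample m)
      = ennreal (\<integral>\<omega>. G \<omega> \<partial>bernoulli_sample (m(e := q)))" .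
qed

text \<open>The logarithm turns the product into a sum over episodes. Whether \<open>e\<close> is
  chosen is settled before its weight in that episode is drawn, so each summand contributes the
  probability of the choice times the relative entropy of means \<open>m e\<close> and
  \<open>q\<close>.\<close>

lemma has_bochner_integral_neg_ln_likelihood_ratio:
  assumes e: "e \<in> {1..L}" and p: "0 < m e" "m e < 1" and q: "0 < q" "q < 1"
  shows "has_bochner_integral (bernoulli_sample m) (\<lambda>\<omega>. - ln (likelihood_ratio m e q n \<omega>))
    (mean_pulls m e n * (m e * ln (m e / q) + (1 - m e) * ln ((1 - m e) / (1 - q))))"
proof -
  define h where "h x = (if x = 1 then ln (m e / q) else ln ((1 - m e) / (1 - q)))" for x :: real
  have [measurable]: "h \<in> borel_measurable borel" unfolding h_def by measurable
  have "- ln (likelihood_ratio m e q n \<omega>) = (\<Sum>t<n. if e \<in> arm \<omega> t then h (snd \<omega> t e) else 0)" for \<omega>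
    unfolding likelihood_ratio_def using p q
    by (subst ln_prod) (auto simp: h_def ln_div simp flip: sum_negf intro!: sum.cong)
  moreover have "has_bochner_integral (bernoulli_sample m)
      (\<lambda>\<omega>. \<Sum>t<n. if e \<in> arm \<omega> t then h (snd \<omega> t e) else 0)
      (\<Sum>t<n. (m e * h 1 + (1 - m e) * h 0)
        * sample.prob m {\<omega> \<in> space (bernoulli_sample m). e \<in> arm \<omega> t})"
  proof (rule has_bochner_integral_sum)
    fix t
    show "has_bochner_integral (bernoulli_sample m) (\<lambda>\<omega>. if e \<in> arm \<omega> t then h (snd \<omega> t e) else 0)
      ((m e * h 1 + (1 - m e) * h 0) * sample.prob m {\<omega> \<in> space (bernoulli_sample m). e \<in> arm \<omega> t})"
      unfolding has_bochner_integral_iff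
      using integrable_fun_on[OF e, where h=h and Q="\<lambda>\<omega>. e \<in> arm \<omega> t"]
        integral_fun_on[where e=e and m=m and h=h and Q="\<lambda>\<omega>. e \<in> arm \<omega> t" and t=t] e p by simp
  qed
  ultimately show ?thesis
    by (simp add: mean_pulls_eq_sum h_def mult.commute flip: sum_distrib_left)
qed

text \<open>The tangent bound \<open>neg_ln_ge\<close> is integrated with \<open>X\<close> as the
  fraction of episodes without \<open>e\<close>; the terms containing the likelihood ratio become
  integrals in the perturbed environment.\<close>

lemma information_lower_bound:
  assumes e: "e \<in> {1..L}" and p: "0 < m e" "m e < 1" and q: "0 < q" "q < 1"
    and n: "n > 0" and c: "c > 0"
  shows "(1 - mean_pulls m e n / real n) * (1 + ln c)
      - c * ((real n - mean_pulls (m(e := q)) e n) / real n) - 1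
    \<le> mean_pulls m e n * (m e * ln (m e / q) + (1 - m e) * ln ((1 - m e) / (1 - q)))"
proof -
  define X where "X \<omega> = 1 - pulls e n \<omega> / real n" for \<omega>
  let ?Z = "likelihood_ratio m e q n"
  have X: "0 \<le> X \<omega>" "X \<omega> \<le> 1" for \<omega>
    using n pulls_nonneg[of e n \<omega>] pulls_le[of e n \<omega>] by (auto simp: X_def)
  have [measurable]: "X \<in> borel_measurable (sample_space U (weight_space L))"
    unfolding X_def by measurable
  have intX: "integrable (bernoulli_sample k) X" for k
    unfolding X_def using integrable_pulls by simp
  have EX: "(\<integral>\<omega>. X \<omega> \<partial>bernoulli_sample k) = 1 - mean_pulls k e n / real n" for k
    unfolding X_def using integrable_pulls[of k e n]
    by (simp add: mean_pulls_eq sample.prob_space)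
  have dep: "X (u, ws) = X (u, ws')" if "hist \<pi> L \<I> u ws n = hist \<pi> L \<I> u ws' n" for u ws ws'
  proof -
    have "arms \<pi> L \<I> u ws s = arms \<pi> L \<I> u ws' s" if "s < n" for s
      using arms_eq_if_hist_eq[OF \<open>hist \<pi> L \<I> u ws n = _\<close> that] .
    then have "pulls e n (u, ws) = pulls e n (u, ws')"
      unfolding pulls_eq_sum by (intro sum.cong) auto
    then show ?thesis by (simp add: X_def)
  qed
  have dep': "1 - X (u, ws) = 1 - X (u, ws')" if "hist \<pi> L \<I> u ws n = hist \<pi> L \<I> u ws' n" for u ws ws'
    using dep[OF that] by simp
  have Z: "?Z \<omega> > 0" for \<omega>
    using p q by (auto simp: likelihood_ratio_def intro!: prod_pos)
  have 1: "has_bochner_integral (bernoulli_sample m) (\<lambda>\<omega>. X \<omega> * ?Z \<omega>)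
      (\<integral>\<omega>. X \<omega> \<partial>bernoulli_sample (m(e := q)))"
    by (rule has_bochner_integral_change_of_measure[where m=m and e=e and G=X and n=n, OF e p _ _ _ dep])
      (use q X intX in auto)
  have 2: "has_bochner_integral (bernoulli_sample m) (\<lambda>\<omega>. (1 - X \<omega>) * ?Z \<omega>)
      (\<integral>\<omega>. 1 - X \<omega> \<partial>bernoulli_sample (m(e := q)))"
    by (rule has_bochner_integral_change_of_measure[where m=m and e=e and G="\<lambda>\<omega>. 1 - X \<omega>" and n=n, OF e p _ _ _ dep'])
      (use q X intX in auto)
  have 3: "has_bochner_integral (bernoulli_sample m) X (1 - mean_pulls m e n / real n)"
    using intX EX by (simp add: has_bochner_integral_iff)
  have 4: "has_bochner_integral (bernoulli_sample m) (\<lambda>\<omega>. 1 - X \<omega>) (mean_pulls m e n / real n)"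
    using intX EX[of m] by (simp add: has_bochner_integral_iff sample.prob_space)
  have EP: "0 \<le> mean_pulls k e n" "mean_pulls k e n \<le> real n" for k
    using integral_mono[OF integrable_pulls, of k "\<lambda>_. real n" e n] pulls_le pulls_nonneg
    by (auto simp: mean_pulls_eq sample.prob_space)
  have lhs: "has_bochner_integral (bernoulli_sample m)
      (\<lambda>\<omega>. X \<omega> * (1 + ln c) - c * (X \<omega> * ?Z \<omega>) + (1 - X \<omega>) - (1 - X \<omega>) * ?Z \<omega>)
      ((1 - mean_pulls m e n / real n) * (1 + ln c)
        - c * (\<integral>\<omega>. X \<omega> \<partial>bernoulli_sample (m(e := q)))
        + mean_pulls m e n / real n - (\<integral>\<omega>. 1 - X \<omega> \<partial>bernoulli_sample (m(e := q))))"
    by (intro has_bochner_integral_diff has_bochner_integral_add has_bochner_integral_mult_left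
        has_bochner_integral_mult_right 1 2 3 4)
  note rhs = has_bochner_integral_neg_ln_likelihood_ratio[where m=m and e=e and n=n, OF e p q]
  have main: "(1 - mean_pulls m e n / real n) * (1 + ln c)
        - c * (\<integral>\<omega>. X \<omega> \<partial>bernoulli_sample (m(e := q)))
        + mean_pulls m e n / real n - (\<integral>\<omega>. 1 - X \<omega> \<partial>bernoulli_sample (m(e := q)))
      \<le> mean_pulls m e n * (m e * ln (m e / q) + (1 - m e) * ln ((1 - m e) / (1 - q)))"
    unfolding has_bochner_integral_integral_eq[OF lhs, symmetric] has_bochner_integral_integral_eq[OF rhs, symmetric]
    by (rule integral_mono[OF integrable.intros[OF lhs] integrable.intros[OF rhs] neg_ln_ge[OF X Z c]])
  have EX': "(\<integral>\<omega>. X \<omega> \<partial>bernoulli_sample (m(e := q)))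
      = (real n - mean_pulls (m(e := q)) e n) / real n"
    using n by (simp add: EX diff_divide_distrib)
  \<comment> \<open>The final \<open>- 1\<close> of the claim absorbs the perturbed mean of
    \<open>1 - X\<close>; the original mean of \<open>1 - X\<close> is nonnegative and is
    dropped.\<close>
  have "(\<integral>\<omega>. 1 - X \<omega> \<partial>bernoulli_sample (m(e := q))) \<le> 1"
    using EX[of "m(e := q)"] EP(2)[of "m(e := q)"] intX n by (simp add: sample.prob_space)
  moreover have "0 \<le> mean_pulls m e n / real n" using EP by simp
  ultimately show ?thesis using main[unfolded EX'] by linarith
qed

section \<open>Means and regret for product Bernoulli weights\<close>

lemma mean_weight_bernoulli_product:
  assumes e: "e \<in> {1..L}" and p: "0 \<le> m e" "m e \<le> 1"
  shows "mean_weight (bernoulli_product L m) e = m e"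
proof -
  have [measurable]: "(\<lambda>w. w e) \<in> borel_measurable (bernoulli_product L m)"
    using e measurable_cong_sets[OF sets_bernoulli_product refl]
    unfolding weight_space_def by (metis measurable_component_singleton)
  have "AE w in bernoulli_product L m. 0 \<le> w e"
    using AE_bernoulli_product[OF e, of m] by eventually_elim auto
  then show ?thesis
    unfolding mean_weight_def
    using nn_integral_bernoulli_product_component[where m=m and e=e and f=ennreal, OF e p] p
    by (subst integral_eq_nn_integral) auto
qed

text \<open>Each choice precedes the weights of its episode, so the expected gain from an item is
  its mean times its expected number of pulls.\<close>

lemma regret_bernoulli_product:
  assumes p: "\<And>e. e \<in> {1..L} \<Longrightarrow> 0 \<le> m e \<and> m e \<le> 1"
    and O: "opt_basis L \<I> (bernoulli_product L m) \<subseteq> {1..L}"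
  shows "regret U \<pi> L \<I> (bernoulli_product L m) n
    = real n * (\<Sum>e\<in>opt_basis L \<I> (bernoulli_product L m). m e) - (\<Sum>e\<in>{1..L}. m e * mean_pulls m e n)"
proof -
  let ?O = "opt_basis L \<I> (bernoulli_product L m)"
  let ?pr = "\<lambda>e t. sample.prob m {\<omega> \<in> space (bernoulli_sample m). e \<in> arm \<omega> t}"
  \<comment> \<open>The test \<open>if True\<close> brings the fixed comparator into the shape of
    \<open>integral_weight_on\<close>.\<close>
  have "has_bochner_integral (bernoulli_sample m)
      (\<lambda>\<omega>. \<Sum>t<n. (\<Sum>e\<in>?O. if True then snd \<omega> t e else 0)
        - (\<Sum>e\<in>{1..L}. if e \<in> arm \<omega> t then snd \<omega> t e else 0))
      (\<Sum>t<n. (\<Sum>e\<in>?O. m e) - (\<Sum>e\<in>{1..L}. m e * ?pr e t))"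
  proof (intro has_bochner_integral_sum has_bochner_integral_diff)
    fix t e assume "e \<in> ?O"
    then show "has_bochner_integral (bernoulli_sample m) (\<lambda>\<omega>. if True then snd \<omega> t e else 0) (m e)"
      using integrable_fun_on[where h="\<lambda>x. x" and Q="\<lambda>_. True" and m=m and e=e and t=t]
        integral_weight_on[where e=e and m=m and Q="\<lambda>_. True" and t=t] O p
      by (auto simp: has_bochner_integral_iff sample.prob_space)
  next
    fix t e assume "e \<in> {1..L}"
    then show "has_bochner_integral (bernoulli_sample m) (\<lambda>\<omega>. if e \<in> arm \<omega> t then snd \<omega> t e else 0)
        (m e * ?pr e t)"
      using integrable_fun_on[where h="\<lambda>x. x" and Q="\<lambda>\<omega>. e \<in> arm \<omega> t" and m=m and e=e and t=t]
        integral_weight_on[where e=e and m=m and Q="\<lambda>\<omega>. e \<in> arm \<omega> t" and t=t] p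
      by (auto simp: has_bochner_integral_iff)
  qed
  moreover have "(\<Sum>e\<in>{1..L}. if e \<in> arm \<omega> t then snd \<omega> t e else 0) = (\<Sum>e\<in>arm \<omega> t. snd \<omega> t e)" for \<omega> t
    using arm_subset[of \<omega> t] by (simp add: sum.If_cases Int_absorb1)
  moreover have "(\<Sum>t<n. (\<Sum>e\<in>?O. m e) - (\<Sum>e\<in>{1..L}. m e * ?pr e t))
      = real n * (\<Sum>e\<in>?O. m e) - (\<Sum>e\<in>{1..L}. m e * mean_pulls m e n)"
    by (simp add: sum_subtractf mean_pulls_eq_sum sum_distrib_left sum.swap[of _ "{..<n}"])
  ultimately show ?thesis
    unfolding regret_def has_bochner_integral_iff by simp
qed

end

subsection \<open>Partition matroids\<close>

locale block_partition =
  fixes L K :: nat and B :: "nat \<Rightarrow> nat set"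
  assumes nonempty: "k \<in> {1..K} \<Longrightarrow> B k \<noteq> {}"
    and disjoint: "k \<in> {1..K} \<Longrightarrow> k' \<in> {1..K} \<Longrightarrow> k \<noteq> k' \<Longrightarrow> B k \<inter> B k' = {}"
    and cover: "(\<Union>k\<in>{1..K}. B k) = {1..L}"
begin

lemma block_subset: "k \<in> {1..K} \<Longrightarrow> B k \<subseteq> {1..L}"
  using cover by blast

lemma finite_block: "k \<in> {1..K} \<Longrightarrow> finite (B k)"
  using block_subset finite_subset by blast

lemma sum_over_blocks:
  fixes f :: "nat \<Rightarrow> 'a::comm_monoid_add"
  assumes "A \<subseteq> {1..L}"
  shows "sum f A = (\<Sum>k\<in>{1..K}. sum f (A \<inter> B k))"
proof -
  have "A = (\<Union>k\<in>{1..K}. A \<inter> B k)" using assms cover by blast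
  then have "sum f A = sum f (\<Union>k\<in>{1..K}. A \<inter> B k)" by simp
  also have "\<dots> = (\<Sum>k\<in>{1..K}. sum f (A \<inter> B k))"
    using finite_block disjoint by (intro sum.UNION_disjoint) blast+
  finally show ?thesis .
qed

lemma card_eq_sum_blocks: "A \<subseteq> {1..L} \<Longrightarrow> card A = (\<Sum>k\<in>{1..K}. card (A \<inter> B k))"
  using sum_over_blocks[of A "\<lambda>_. 1::nat"] by simp

lemma insert_mem_partition_indep:
  assumes A: "A \<in> partition_indep L K B" and k: "k \<in> {1..K}" and e: "e \<in> B k" and "A \<inter> B k = {}"
  shows "insert e A \<in> partition_indep L K B"
proof -
  have "card (insert e A \<inter> B j) \<le> 1" if j: "j \<in> {1..K}" for j
  proof (cases "j = k")
    case True
    then have "insert e A \<inter> B j = {e}" using assms by auto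
    then show ?thesis by simp
  next
    case False
    then have "insert e A \<inter> B j = A \<inter> B j" using disjoint[OF j k False] e by auto
    then show ?thesis using A j by (simp add: partition_indep_def)
  qed
  then show ?thesis
    using A block_subset[OF k] e by (auto simp: partition_indep_def)
qed

lemma matroid_partition_indep: "matroid {1..L} (partition_indep L K B)"
  unfolding matroid_def
proof (intro conjI allI impI)
  show "{} \<in> partition_indep L K B" by (simp add: partition_indep_def)
  show "Y \<in> partition_indep L K B" if "X \<in> partition_indep L K B \<and> Y \<subseteq> X" for X Y
  proof -
    have "card (Y \<inter> B k) \<le> 1" if k: "k \<in> {1..K}" for k
    proof -
      have "card (Y \<inter> B k) \<le> card (X \<inter> B k)"
        using finite_block[OF k] \<open>_ \<and> Y \<subseteq> X\<close> by (intro card_mono) auto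
      also have "\<dots> \<le> 1" using \<open>X \<in> _ \<and> _\<close> k by (simp add: partition_indep_def)
      finally show ?thesis .
    qed
    then show ?thesis using that by (auto simp: partition_indep_def)
  qed
  fix X Y assume XY: "X \<in> partition_indep L K B \<and> Y \<in> partition_indep L K B \<and> card X < card Y"
  then have sub: "X \<subseteq> {1..L}" "Y \<subseteq> {1..L}" by (auto simp: partition_indep_def)
  \<comment> \<open>Counting blockwise, the larger set must meet some block that the smaller one
    misses; an item from there augments it.\<close>
  have "(\<Sum>k\<in>{1..K}. card (X \<inter> B k)) < (\<Sum>k\<in>{1..K}. card (Y \<inter> B k))"
    using XY card_eq_sum_blocks[OF sub(1)] card_eq_sum_blocks[OF sub(2)] by simp
  then obtain k where k: "k \<in> {1..K}" "card (X \<inter> B k) < card (Y \<inter> B k)"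
    by (meson sum_mono not_le)
  have "card (Y \<inter> B k) \<le> 1" using XY k(1) by (simp add: partition_indep_def)
  then have "card (X \<inter> B k) = 0" "Y \<inter> B k \<noteq> {}" using k(2) by auto
  then have "X \<inter> B k = {}" and "\<exists>e. e \<in> Y \<inter> B k" using finite_block[OF k(1)] by auto
  then show "\<exists>e\<in>Y - X. insert e X \<in> partition_indep L K B"
    using insert_mem_partition_indep[OF _ k(1)] XY by blast
qed (auto simp: partition_indep_def)

lemma basis_partition_iff:
  "basis (partition_indep L K B) A \<longleftrightarrow> A \<subseteq> {1..L} \<and> (\<forall>k\<in>{1..K}. card (A \<inter> B k) = 1)"
proof
  assume basis: "basis (partition_indep L K B) A"
  then have A: "A \<in> partition_indep L K B" by (simp add: basis_def)
  have "card (A \<inter> B k) = 1" if k: "k \<in> {1..K}" for k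
  proof (rule ccontr)
    assume "card (A \<inter> B k) \<noteq> 1"
    moreover have "card (A \<inter> B k) \<le> 1" using A k by (simp add: partition_indep_def)
    ultimately have "A \<inter> B k = {}" using finite_block[OF k] by (auto simp: le_less)
    moreover obtain e where e: "e \<in> B k" using nonempty[OF k] by blast
    ultimately have "insert e A = A"
      using insert_mem_partition_indep[OF A k e] basis unfolding basis_def by blast
    with e \<open>A \<inter> B k = {}\<close> show False by blast
  qed
  with A show "A \<subseteq> {1..L} \<and> (\<forall>k\<in>{1..K}. card (A \<inter> B k) = 1)" by (simp add: partition_indep_def)
next
  assume A: "A \<subseteq> {1..L} \<and> (\<forall>k\<in>{1..K}. card (A \<inter> B k) = 1)"
  \<comment> \<open>\<open>A\<close> already exhausts the single item that \<open>C\<close> may have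
    in each block.\<close>
  have "C = A" if C: "C \<in> partition_indep L K B" and "A \<subseteq> C" for C
  proof -
    have "C \<inter> B k = A \<inter> B k" if k: "k \<in> {1..K}" for k
      using card_seteq[of "C \<inter> B k" "A \<inter> B k"] finite_block[OF k] A C \<open>A \<subseteq> C\<close> k
      by (auto simp: partition_indep_def)
    moreover have "C \<subseteq> (\<Union>k\<in>{1..K}. B k)" using C cover by (auto simp: partition_indep_def)
    ultimately show ?thesis using \<open>A \<subseteq> C\<close> by blast
  qed
  with A show "basis (partition_indep L K B) A" by (auto simp: basis_def partition_indep_def)
qed

lemma card_basis: "basis (partition_indep L K B) A \<Longrightarrow> card A = K"
  using card_eq_sum_blocks[of A] by (simp add: basis_partition_iff)

text \<open>Exchange argument: a basis containing \<open>e\<close> becomes strictly better when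
  \<open>e\<close> is swapped for \<open>j\<close> of the same block.\<close>

lemma not_mem_optimal_basis:
  assumes k: "k \<in> {1..K}" and e: "e \<in> B k" and j: "j \<in> B k"
    and less: "mean_weight P e < mean_weight P j"
  shows "e \<notin> \<Union> (optimal_bases L (partition_indep L K B) P)"
proof
  assume "e \<in> \<Union> (optimal_bases L (partition_indep L K B) P)"
  then obtain A where basis: "basis (partition_indep L K B) A" and eA: "e \<in> A"
    and opt: "\<And>C. basis (partition_indep L K B) C \<Longrightarrow> sum (mean_weight P) C \<le> sum (mean_weight P) A"
    by (auto simp: optimal_bases_def)
  have A: "A \<subseteq> {1..L}" "\<And>i. i \<in> {1..K} \<Longrightarrow> card (A \<inter> B i) = 1"
    using basis by (auto simp: basis_partition_iff)
  have fin: "finite A" using A(1) finite_subset by blast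
  have Ak: "A \<inter> B k = {e}" using A(2)[OF k] eA e by (metis IntI card_1_singletonE singletonD)
  then have jA: "j \<notin> A" using j less by auto
  let ?C = "insert j (A - {e})"
  have "card (?C \<inter> B i) = 1" if i: "i \<in> {1..K}" for i
  proof (cases "i = k")
    case True
    then have "?C \<inter> B i = {j}" using Ak j by auto
    then show ?thesis by simp
  next
    case False
    then have "?C \<inter> B i = A \<inter> B i" using disjoint[OF i k False] e j by auto
    then show ?thesis using A(2)[OF i] by simp
  qed
  then have "basis (partition_indep L K B) ?C"
    using A(1) block_subset[OF k] j by (auto simp: basis_partition_iff)
  from opt[OF this] have "mean_weight P j \<le> mean_weight P e"
    using fin eA jA by (simp add: sum.remove[of A e])
  with less show False by simp
qed

text \<open>These are the items of mean 1/2 in the instance; they form a basis, and the lower bound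
  is summed over its complement.\<close>

definition leaders :: "nat set" where
  "leaders = (\<lambda>k. Min (B k)) ` {1..K}"

lemma leader_in_block: "k \<in> {1..K} \<Longrightarrow> Min (B k) \<in> B k"
  using finite_block nonempty by simp

lemma leaders_Int_block:
  assumes k: "k \<in> {1..K}"
  shows "leaders \<inter> B k = {Min (B k)}"
proof -
  have "Min (B i) \<notin> B k" if "i \<in> {1..K}" "i \<noteq> k" for i
    using leader_in_block[OF that(1)] disjoint[OF that(1) k that(2)] by blast
  then show ?thesis using leader_in_block[OF k] k unfolding leaders_def by blast
qed

lemma basis_leaders: "basis (partition_indep L K B) leaders"
proof -
  have "leaders \<subseteq> {1..L}" using block_subset leader_in_block unfolding leaders_def by blast
  then show ?thesis by (simp add: basis_partition_iff leaders_Int_block)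
qed

lemma instance_mean_eq: "instance_mean K B \<Delta> e = (if e \<in> leaders then 1/2 else 1/2 - \<Delta>)"
  using leader_in_block by (auto simp: instance_mean_def leaders_def)

end

section \<open>Bandit algorithms on partition matroids\<close>

locale partition_bandit_algorithm = block_partition L K B +
  matroid_algorithm U \<pi> L "partition_indep L K B"
  for L K B and U :: "'u measure" and \<pi> :: "'u policy"
begin

text \<open>A basis has exactly one item in each block. Hence episodes without \<open>e\<close> are
  the pulls of the other items in its block.\<close>

lemma sum_mean_pulls_block:
  assumes k: "k \<in> {1..K}"
  shows "(\<Sum>e\<in>B k. mean_pulls m e n) = real n"
proof -
  have "(\<Sum>e\<in>B k. pulls e n \<omega>) = real n" for \<omega>
  proof -
    have "(\<Sum>e\<in>B k. if e \<in> arm \<omega> t then 1 else 0 :: real) = 1" for t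
      using basis_arm[of \<omega> t] k finite_block[OF k] by (simp add: sum.If_cases basis_partition_iff Int_commute)
    then show ?thesis unfolding pulls_eq_sum by (subst sum.swap) simp
  qed
  then have "(\<integral>\<omega>. (\<Sum>e\<in>B k. pulls e n \<omega>) \<partial>bernoulli_sample m) = real n"
    by (simp add: sample.prob_space)
  then show ?thesis
    by (simp add: mean_pulls_eq integrable_pulls)
qed

lemma sum_mean_pulls: "(\<Sum>e\<in>{1..L}. mean_pulls m e n) = real K * real n"
  using sum_over_blocks[of "{1..L}" "\<lambda>e. mean_pulls m e n"] sum_mean_pulls_block block_subset
  by (simp add: Int_absorb1)

text \<open>\<open>opt_basis\<close> is a \<open>SOME\<close> choice, so an optimal basis must first
  be exhibited: \<open>leaders\<close> attains the upper bound 1/2 per item on every basis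
  weight.\<close>

lemma opt_basis_properties:
  assumes \<Delta>: "0 < \<Delta>" "\<Delta> < 1/2"
  defines "m \<equiv> instance_mean K B \<Delta>"
  defines "A \<equiv> opt_basis L (partition_indep L K B) (bernoulli_product L m)"
  shows "A \<subseteq> {1..L}" and "real K / 2 \<le> sum m A"
proof -
  have mw: "mean_weight (bernoulli_product L m) e = m e" if "e \<in> {1..L}" for e
    using mean_weight_bernoulli_product[OF that, of m] \<Delta> by (simp add: m_def instance_mean_eq)
  have mws: "sum (mean_weight (bernoulli_product L m)) C = sum m C" if "basis (partition_indep L K B) C" for C
    using that mw by (intro sum.cong) (auto simp: basis_partition_iff)
  have sum_leaders: "sum m leaders = real K / 2"
    using card_basis[OF basis_leaders] by (simp add: m_def instance_mean_eq)
  have "sum m C \<le> real K / 2" if "basis (partition_indep L K B) C" for C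
    using sum_mono[of C m "\<lambda>_. 1/2"] card_basis[OF that] \<Delta> by (simp add: m_def instance_mean_eq)
  then have "leaders \<in> optimal_bases L (partition_indep L K B) (bernoulli_product L m)"
    using basis_leaders by (simp add: optimal_bases_def mws sum_leaders)
  then have "A \<in> optimal_bases L (partition_indep L K B) (bernoulli_product L m)"
    unfolding A_def opt_basis_def by (rule someI)
  then have A: "basis (partition_indep L K B) A"
    "sum (mean_weight (bernoulli_product L m)) leaders \<le> sum (mean_weight (bernoulli_product L m)) A"
    using basis_leaders by (auto simp: optimal_bases_def)
  then show "A \<subseteq> {1..L}" "real K / 2 \<le> sum m A"
    using basis_leaders by (auto simp: basis_partition_iff mws sum_leaders)
qed

text \<open>Pulls total \<open>K * n\<close>. Were all of them worth 1/2, the gain would be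
  \<open>K * n / 2\<close>, and every pull outside \<open>leaders\<close> loses
  \<open>\<Delta>\<close> against that.\<close>

lemma regret_ge:
  assumes \<Delta>: "0 < \<Delta>" "\<Delta> < 1/2"
  defines "m \<equiv> instance_mean K B \<Delta>"
  shows "\<Delta> * (\<Sum>e\<in>{1..L} - leaders. mean_pulls m e n)
    \<le> regret U \<pi> L (partition_indep L K B) (bernoulli_product L m) n"
proof -
  let ?A = "opt_basis L (partition_indep L K B) (bernoulli_product L m)"
  have A: "?A \<subseteq> {1..L}" "real K / 2 \<le> sum m ?A"
    using opt_basis_properties[OF \<Delta>] by (simp_all add: m_def)
  have "(\<Sum>e\<in>{1..L}. m e * mean_pulls m e n)
      = (\<Sum>e\<in>{1..L}. mean_pulls m e n / 2 - (if e \<in> {1..L} - leaders then \<Delta> * mean_pulls m e n else 0))"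
    by (intro sum.cong) (auto simp: m_def instance_mean_eq algebra_simps)
  also have "\<dots> = real K * real n / 2 - \<Delta> * (\<Sum>e\<in>{1..L} - leaders. mean_pulls m e n)"
  proof -
    have "(\<Sum>e\<in>{1..L}. if e \<in> {1..L} - leaders then \<Delta> * mean_pulls m e n else 0)
        = (\<Sum>e\<in>{1..L} - leaders. \<Delta> * mean_pulls m e n)"
      by (intro sum.mono_neutral_cong_right) auto
    then show ?thesis
      unfolding sum_subtractf sum_mean_pulls sum_divide_distrib[symmetric] sum_distrib_left by simp
  qed
  finally have "(\<Sum>e\<in>{1..L}. m e * mean_pulls m e n)
      = real K * real n / 2 - \<Delta> * (\<Sum>e\<in>{1..L} - leaders. mean_pulls m e n)" .
  moreover have "real n * (real K / 2) \<le> real n * sum m ?A" using A(2) by (intro mult_left_mono) auto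
  moreover have "regret U \<pi> L (partition_indep L K B) (bernoulli_product L m) n
      = real n * sum m ?A - (\<Sum>e\<in>{1..L}. m e * mean_pulls m e n)"
    using \<Delta> A(1) by (intro regret_bernoulli_product) (auto simp: m_def instance_mean_eq)
  ultimately show ?thesis by (simp add: mult.commute)
qed

text \<open>The better item \<open>j\<close> is left free: it is the leader in the original instance
  and the raised item in the perturbed one.\<close>

lemma consistent_mean_pulls_smallo:
  assumes cons: "consistent U \<pi>" and k: "k \<in> {1..K}" and e: "e \<in> B k" and j: "j \<in> B k"
    and p: "\<And>i. i \<in> {1..L} \<Longrightarrow> 0 \<le> m i \<and> m i \<le> 1" and less: "m e < m j" and "\<alpha> > 0"
  shows "mean_pulls m e \<in> o(\<lambda>n. real n powr \<alpha>)"
proof -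
  have ej: "e \<in> {1..L}" "j \<in> {1..L}" using e j block_subset[OF k] by auto
  then have "mean_weight (bernoulli_product L m) e < mean_weight (bernoulli_product L m) j"
    using p less by (simp add: mean_weight_bernoulli_product)
  from not_mem_optimal_basis[OF k e j this] show ?thesis
    using cons ej matroid_partition_indep bandit_dist_bernoulli_product \<open>\<alpha> > 0\<close>
    unfolding consistent_def by blast
qed

lemma eventually_mean_pulls_ge:
  assumes cons: "consistent U \<pi>" and \<Delta>: "0 < \<Delta>" "\<Delta> < 1/2" and e: "e \<in> {1..L} - leaders"
    and y: "y < 1 / (4 * \<Delta>\<^sup>2)"
  shows "eventually (\<lambda>n. y * ln (real n) < mean_pulls (instance_mean K B \<Delta>) e n) sequentially"
proof -
  define m where "m = instance_mean K B \<Delta>"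
  \<comment> \<open>As \<open>q\<close> tends to 1/2 the divergence bound tends to
    \<open>4 * \<Delta>\<^sup>2\<close>, so the strict bound on \<open>y\<close> leaves room for
    some \<open>q > 1/2\<close>, which makes \<open>e\<close> strictly better than its
    leader.\<close>
  have "((\<lambda>q. y * ((1/2 - \<Delta> - q)\<^sup>2 / (q * (1 - q)))) \<longlongrightarrow> y * ((1/2 - \<Delta> - 1/2)\<^sup>2 / (1/2 * (1 - 1/2)))) (at_right (1/2))"
    by (intro tendsto_intros) auto
  moreover have "y * ((1/2 - \<Delta> - 1/2)\<^sup>2 / (1/2 * (1 - 1/2))) < 1"
    using y \<Delta> by (simp add: field_simps)
  ultimately have "eventually (\<lambda>q. y * ((1/2 - \<Delta> - q)\<^sup>2 / (q * (1 - q))) < 1) (at_right (1/2))"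
    by (rule order_tendstoD)
  moreover have "eventually (\<lambda>q::real. q \<in> {1/2<..<1}) (at_right (1/2))"
    by (rule eventually_at_right_real) simp
  ultimately have "eventually (\<lambda>q. y * ((1/2 - \<Delta> - q)\<^sup>2 / (q * (1 - q))) < 1 \<and> 1/2 < q \<and> q < 1) (at_right (1/2))"
    by eventually_elim auto
  then obtain q where q: "y * ((1/2 - \<Delta> - q)\<^sup>2 / (q * (1 - q))) < 1" "1/2 < q" "q < 1"
    using eventually_happens'[OF trivial_limit_at_right_real] by blast
  define \<kappa> where "\<kappa> = (1/2 - \<Delta> - q)\<^sup>2 / (q * (1 - q))"
  have me: "m e = 1/2 - \<Delta>" using e by (simp add: m_def instance_mean_eq)
  obtain k where k: "k \<in> {1..K}" "e \<in> B k" using e cover by blast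
  have j: "Min (B k) \<in> B k" "m (Min (B k)) = 1/2"
    using leader_in_block[OF k(1)] k(1) by (auto simp: m_def instance_mean_eq leaders_def)
  have m01: "0 \<le> m i \<and> m i \<le> 1 \<and> m i \<le> 1/2" for i using \<Delta> by (auto simp: m_def instance_mean_eq)
  have mq: "m i < q" for i using m01[of i] q(2) by linarith
  have others: "real n - mean_pulls (m(e := q)) e n = (\<Sum>i\<in>B k - {e}. mean_pulls (m(e := q)) i n)" for n
    using sum_mean_pulls_block[OF k(1), of "m(e := q)" n] finite_block[OF k(1)] k(2)
    by (simp add: sum.remove)
  have nonneg: "0 \<le> mean_pulls m e n" for n
    unfolding mean_pulls_eq using pulls_nonneg by (simp add: integral_nonneg_AE)
  have "eventually (\<lambda>n. y * ln (real n) < mean_pulls m e n) sequentially"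
  proof (rule eventually_log_lower_bound)
    fix \<alpha> :: real assume "\<alpha> > 0"
    then show "mean_pulls m e \<in> o(\<lambda>n. real n powr \<alpha>)"
      using m01 me j \<Delta> by (intro consistent_mean_pulls_smallo[OF cons k j(1)]) auto
    \<comment> \<open>In the perturbed instance every other item of the block has mean below
      \<open>q\<close>, so consistency controls all of them, and by \<open>others\<close> their
      sum.\<close>
    have "mean_pulls (m(e := q)) i \<in> o(\<lambda>n. real n powr \<alpha>)" if "i \<in> B k - {e}" for i
      using m01 mq q \<open>\<alpha> > 0\<close> that k
      by (intro consistent_mean_pulls_smallo[OF cons k(1) _ k(2)]) auto
    then show "(\<lambda>n. real n - mean_pulls (m(e := q)) e n) \<in> o(\<lambda>n. real n powr \<alpha>)"
      unfolding others by (intro big_sum_in_smallo) auto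
  next
    fix n :: nat and c :: real assume nc: "n > 0" "c > 0"
    have "(1 - mean_pulls m e n / real n) * (1 + ln c)
          - c * ((real n - mean_pulls (m(e := q)) e n) / real n) - 1
        \<le> mean_pulls m e n * (m e * ln (m e / q) + (1 - m e) * ln ((1 - m e) / (1 - q)))"
      using e me \<Delta> q nc by (intro information_lower_bound) auto
    also have "\<dots> \<le> mean_pulls m e n * \<kappa>"
      using bernoulli_kl_le[of "m e" q] me \<Delta> q nonneg
      unfolding \<kappa>_def by (intro mult_left_mono) auto
    finally show "(1 - mean_pulls m e n / real n) * (1 + ln c)
          - c * ((real n - mean_pulls (m(e := q)) e n) / real n) - 1 \<le> mean_pulls m e n * \<kappa>" .
  next
    show "\<kappa> > 0" using q \<Delta> by (auto simp: \<kappa>_def)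
    show "y * \<kappa> < 1" using q(1) by (simp add: \<kappa>_def)
  qed
  then show ?thesis by (simp add: m_def)
qed

end

section \<open>The limit inferior of the normalized regret\<close>

lemma instance_dist_eq: "instance_dist L K B \<Delta> = bernoulli_product L (instance_mean K B \<Delta>)"
  by (simp add: instance_dist_def bernoulli_product_def)

theorem theorem4:
  fixes L K :: nat and \<Delta> :: real and B :: "nat \<Rightarrow> nat set"
    and U :: "'u measure" and \<pi> :: "'u policy"
  assumes "L > K" and "K \<ge> 1" and "0 < \<Delta>" and "\<Delta> < 1/2"
    and "\<forall>k\<in>{1..K}. B k \<noteq> {}"
    and "\<forall>k\<in>{1..K}. \<forall>k'\<in>{1..K}. k \<noteq> k' \<longrightarrow> B k \<inter> B k' = {}"
    and "(\<Union>k\<in>{1..K}. B k) = {1..L}"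
    and "algorithm U \<pi>" and "consistent U \<pi>"
  shows "Liminf sequentially
           (\<lambda>n. ereal (regret U \<pi> L (partition_indep L K B) (instance_dist L K B \<Delta>) n / ln (real n)))
         \<ge> ereal (real (L - K) / (4 * \<Delta>))"
proof -
  interpret block_partition L K B using assms(5-7) by unfold_locales auto
  interpret partition_bandit_algorithm L K B U \<pi>
    using assms(8) matroid_partition_indep by unfold_locales auto
  let ?m = "instance_mean K B \<Delta>"
  let ?R = "regret U \<pi> L (partition_indep L K B) (instance_dist L K B \<Delta>)"
  have "leaders \<subseteq> {1..L}" using basis_leaders by (simp add: basis_partition_iff)
  then have card: "card ({1..L} - leaders) = L - K"
    using card_basis[OF basis_leaders] by (simp add: card_Diff_subset finite_subset)
  \<comment> \<open>The limit inferior is bounded by checking every extended real \<open>z\<close>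
    strictly below the target.\<close>
  have ev: "eventually (\<lambda>n. z < ereal (?R n / ln (real n))) sequentially"
    if z: "z < ereal (real (L - K) / (4 * \<Delta>))" for z
  proof -
    obtain x where x: "z < ereal x" "x < real (L - K) / (4 * \<Delta>)"
      using ereal_dense2[OF z] by auto
    \<comment> \<open>\<open>y\<close> is the share of \<open>x\<close> per item outside
      \<open>leaders\<close>, with the cost \<open>\<Delta>\<close> per pull divided out; the bound
      on \<open>x\<close> becomes \<open>y < 1 / (4 * \<Delta>\<^sup>2)\<close>.\<close>
    define y where "y = x / (\<Delta> * real (L - K))"
    have pos: "\<Delta> * real (L - K) > 0" using assms(1,3) by simp
    have xy: "x = \<Delta> * real (L - K) * y" using assms(1,3) by (simp add: y_def)
    have "y < real (L - K) / (4 * \<Delta>) / (\<Delta> * real (L - K))"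
      unfolding y_def using x(2) pos by (rule divide_strict_right_mono)
    also have "\<dots> = 1 / (4 * \<Delta>\<^sup>2)"
      using assms(1,3) by (simp add: power2_eq_square)
    finally have "eventually (\<lambda>n. \<forall>e\<in>{1..L} - leaders. y * ln (real n) < mean_pulls ?m e n) sequentially"
      using eventually_mean_pulls_ge[OF assms(9,3,4)] by (intro eventually_ball_finite) auto
    then show ?thesis using eventually_gt_at_top[of 1]
    proof eventually_elim
      case (elim n)
      have ln: "ln (real n) > 0" using elim(2) by simp
      have "real (L - K) * (y * ln (real n)) \<le> (\<Sum>e\<in>{1..L} - leaders. mean_pulls ?m e n)"
        using sum_mono[of "{1..L} - leaders" "\<lambda>_. y * ln (real n)" "\<lambda>e. mean_pulls ?m e n"] elim(1) card
        by (simp add: less_imp_le)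
      then have "\<Delta> * (real (L - K) * (y * ln (real n))) \<le> \<Delta> * (\<Sum>e\<in>{1..L} - leaders. mean_pulls ?m e n)"
        using assms(3) by (intro mult_left_mono) auto
      also have "\<dots> \<le> ?R n"
        using regret_ge[OF assms(3,4), of n] by (simp add: instance_dist_eq)
      finally have "x * ln (real n) \<le> ?R n" unfolding xy by (simp only: mult.assoc)
      then have "x \<le> ?R n / ln (real n)" using ln by (simp add: le_divide_eq)
      then show ?case using x(1) by (meson ereal_less_eq(3) less_le_trans)
    qed
  qed
  then show ?thesis by (simp add: le_Liminf_iff)
qed

end
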